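(* Let $F=(F_1,\dots,F_m):\mathbb{R}^n\to\mathbb{R}^m$ be continuously differentiable and let $\mathcal{L}\subset[m]$ with $\mathcal{L}\neq\emptyset$ and $[m]\setminus\mathcal{L}\ne\emptyset$. Let $\{x^k\}_{k\ge0}$ be an infinite sequence of non-critical points generated by the BBDMO\_VM algorithm with matrices $\{B_k\}$, and suppose there exist constants $a,b>0$ with $aI\preceq B_k\preceq bI$ for all $k$. Assume that $F_i$ is linear for $i\in\mathcal{L}$, and that for every $i\in[m]\setminus\mathcal{L}$ and every $k\ge0$ the function $F_i$ is $L_i^k$-smooth and $\mu_i^k$-strongly convex relative to $\|\cdot\|_{B_k}$, where $L_i\ge L_i^k$ and $\mu_i^k\ge\delta_i>0$ for constants $L_i,\delta_i$ independent of $k$. Then: (i) $\{x^k\}$ converges to some Pareto solution $x^*$ of $\min_{x\in\mathbb{R}^n}F(x)$. (ii) For every $k\ge0$, $$u_0^{\delta^\alpha}(x^{k+1})\le\left(1-2\gamma\sigma(1-\sigma)(1-c\,\alpha_{\min})\min_{i\in[m]\setminus\mathcal{L}}\left\{\frac{\mu_i^k\delta_i^2}{(L_i^k)^3}\right\}\right)u_0^{\delta^\alpha}(x^k).$$ Here $u_0^{\delta^\alpha}(x):=\sup_{y\in\mathbb{R}^n}\min_{i\in[m]}\left\{\frac{F_i(x)-F_i(y)}{\delta_i^\alpha}\right\}$ with $\delta^\alpha_i=\delta_i$ for $i\in[m]\setminus\mathcal{L}$ and $\delta^\alpha_i=\alpha_{\min}$ for $i\in\mathcal{L}$, and $$c:=\left(1+\frac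 ba\right)\max_{i\in[m]\setminus\mathcal{L}}\frac{\|\nabla F_i(x^0)\|+bL_iR}{\epsilon\,\delta_i},$$ where $R:=\max\{\|x-y\|:x,y\in\mathcal{L}_F(x^0)\}$, $\mathcal{L}_F(x^0)=\{x\in\mathbb{R}^n:F_i(x)\le F_i(x^0)\ \forall i\in[m]\}$, and $\epsilon:=\min\{\|v\|:v\in C\}>0$, with $C$ the convex hull of the (constant) gradients of $F_i$, $i\in\mathcal{L}$.
   Context: Notation: $[m]=\{1,\dots,m\}$; $\|\cdot\|$ is the Euclidean norm; $\|x\|_B=\sqrt{\langle x,Bx\rangle}$ for a symmetric positive definite matrix $B$; for symmetric matrices $U\preceq V$ means $V-U$ is positive semidefinite. A differentiable $h:\mathbb{R}^n\to\mathbb{R}$ is $L$-smooth relative to $\|\cdot\|_B$ if $h(y)\le h(x)+\langle\nabla h(x),y-x\rangle+\frac L2\|y-x\|_B^2$ for all $x,y\in\mathbb{R}^n$, and $\mu$-strongly convex relative to $\|\cdot\|_B$ if $h(y)\ge h(x)+\langle\nabla h(x),y-x\rangle+\frac\mu2\|y-x\|_B^2$ for all $x,y\in\mathbb{R}^n$. A point $x^*$ is a Pareto solution if there is no $x\in\mathbb{R}^n$ with $F_i(x)\le F_i(x^* )$ for all $i\in[m]$ and $F(x)\ne F(x^* )$. A point $x$ is Pareto critical if there is no $d\in\mathbb{R}^n$ with $\langle\nabla F_i(x),d\rangle<0$ for all $i\in[m]$; otherwise it is non-critical. BBDMO\_VM algorithm (Barzilai-Borwein descent method with variable metrics). Parameters: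 $0<\alpha_{\min}\le\alpha_{\max}$, $\sigma,\gamma\in(0,1)$. Data: $x^0\in\mathbb{R}^n$, a point $x^{-1}\neq x^0$ near $x^0$, and symmetric positive definite matrices $B_0,B_1,\dots$ ($B_{k+1}$ being chosen, by any rule, at the end of iteration $k$). For $k=0,1,2,\dots$: 1. With $s^{k-1}=x^k-x^{k-1}$ and $y_i^{k-1}=\nabla F_i(x^k)-\nabla F_i(x^{k-1})$, set for each $i\in[m]$: $\alpha_i^k=\max\{\alpha_{\min},\min\{\langle s^{k-1},y_i^{k-1}\rangle/\|s^{k-1}\|_{B_k}^2,\ \alpha_{\max}\}\}$ if $\langle s^{k-1},y_i^{k-1}\rangle>0$; $\alpha_i^k=\max\{\alpha_{\min},\min\{\|y_i^{k-1}\|/\|B_ks^{k-1}\|,\ \alpha_{\max}\}\}$ if $\langle s^{k-1},y_i^{k-1}\rangle<0$; $\alpha_i^k=\alpha_{\min}$ if $\langle s^{k-1},y_i^{k-1}\rangle=0$. 2. Let $d^k$ be the unique minimizer over $d\in\mathbb{R}^n$ of $\max_{i\in[m]}\left\{\frac{\langle\nabla F_i(x^k),d\rangle}{\alpha_i^k}+\frac12\|d\|_{B_k}^2\right\}$. 3. If $d^k=0$, stop and return $x^k$. Otherwise let $t_k$ be the largest element of $\{1,\gamma,\gamma^2,\dots\}$ such that $F_i(x^k+t_kd^k)-F_i(x^k)\le t_k\sigma\langle\nabla F_i(x^k),d^k\rangle$ for all $i\in[m]$ (Armijo backtracking), and set $x^{k+1}=x^k+t_kd^k$. Standing convention: $\alpha_{\min}$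 is sufficiently small and $\alpha_{\max}$ sufficiently large, meaning $\alpha_{\min}\le L_i^k$ and $\alpha_{\max}\ge\mu_i^k$ for all $i\in[m]\setminus\mathcal{L}$ and $k\ge0$ (so that $\mu_i^k\le\alpha_i^k\le L_i^k$ for these $i$). *)

theory Defs
  imports "HOL-Analysis.Analysis"
begin

(* Conventions: the index set [m] is the finite type 'm, the decision space R^n is real^'n, and
   F_i is the component (\<lambda>x. F x $ i). *)

(* Meaningful at points of differentiability only; see GDERIV_grad. *)
definition grad :: "(real^'n \<Rightarrow> real) \<Rightarrow> real^'n \<Rightarrow> real^'n" where
  "grad h x = (THE g. GDERIV h x :> g)"

lemma grad_eqI:
  assumes "GDERIV h x :> g"
  shows "grad h x = g"
  unfolding grad_def
proof (rule the_equality)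
  fix g' assume "GDERIV h x :> g'"
  then have "(\<lambda>v. inner v g') = (\<lambda>v. inner v g)"
    using assms has_derivative_unique unfolding gderiv_def by blast
  then show "g' = g"
    by (metis vector_eq_ldot)
qed (rule assms)

lemma GDERIV_grad:
  assumes "h differentiable (at x)"
  shows "GDERIV h x :> grad h x"
proof -
  obtain D where D: "(h has_derivative D) (at x)"
    using assms unfolding differentiable_def by blast
  then have lin: "linear D"
    by (rule has_derivative_linear)
  have "D = (\<lambda>v. inner v (adjoint D 1))"
    using adjoint_works[OF lin, of _ 1] by (auto simp: fun_eq_iff)
  with D have "GDERIV h x :> adjoint D 1"
    unfolding gderiv_def by simp
  then show ?thesis
    using grad_eqI by metis
qed

definition continuously_diff :: "(real^'n \<Rightarrow> real^'m) \<Rightarrow> bool" where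
  "continuously_diff F \<longleftrightarrow>
     (\<forall>i. (\<forall>x. (\<lambda>x. F x $ i) differentiable (at x)) \<and>
          continuous_on UNIV (grad (\<lambda>x. F x $ i)))"

definition sym_pos_def :: "real^'n^'n \<Rightarrow> bool" where
  "sym_pos_def B \<longleftrightarrow> transpose B = B \<and> (\<forall>v. v \<noteq> 0 \<longrightarrow> 0 < v \<bullet> (B *v v))"

definition loewner_le :: "real^'n^'n \<Rightarrow> real^'n^'n \<Rightarrow> bool" where
  "loewner_le U V \<longleftrightarrow> transpose U = U \<and> transpose V = V \<and> (\<forall>v. 0 \<le> v \<bullet> ((V - U) *v v))"

definition norm_B :: "real^'n^'n \<Rightarrow> real^'n \<Rightarrow> real" where
  "norm_B B v = sqrt (v \<bullet> (B *v v))"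

definition rel_smooth :: "real \<Rightarrow> real^'n^'n \<Rightarrow> (real^'n \<Rightarrow> real) \<Rightarrow> bool" where
  "rel_smooth L B h \<longleftrightarrow> (\<forall>x. h differentiable (at x)) \<and>
     (\<forall>x y. h y \<le> h x + grad h x \<bullet> (y - x) + L / 2 * (norm_B B (y - x))\<^sup>2)"

definition rel_strongly_convex :: "real \<Rightarrow> real^'n^'n \<Rightarrow> (real^'n \<Rightarrow> real) \<Rightarrow> bool" where
  "rel_strongly_convex \<mu> B h \<longleftrightarrow> (\<forall>x. h differentiable (at x)) \<and>
     (\<forall>x y. h y \<ge> h x + grad h x \<bullet> (y - x) + \<mu> / 2 * (norm_B B (y - x))\<^sup>2)"

(* "Linear" objectives in the sense of optimization: a constant term is allowed. *)
definition linear_objective :: "(real^'n \<Rightarrow> real) \<Rightarrow> bool" where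
  "linear_objective h \<longleftrightarrow> (\<exists>g \<beta>. \<forall>x. h x = g \<bullet> x + \<beta>)"

definition pareto_solution :: "(real^'n \<Rightarrow> real^'m) \<Rightarrow> real^'n \<Rightarrow> bool" where
  "pareto_solution F xs \<longleftrightarrow> \<not> (\<exists>x. (\<forall>i. F x $ i \<le> F xs $ i) \<and> F x \<noteq> F xs)"

definition pareto_critical :: "(real^'n \<Rightarrow> real^'m) \<Rightarrow> real^'n \<Rightarrow> bool" where
  "pareto_critical F x \<longleftrightarrow> \<not> (\<exists>d. \<forall>i. grad (\<lambda>x. F x $ i) x \<bullet> d < 0)"

definition bb_step :: "real \<Rightarrow> real \<Rightarrow> real^'n^'n \<Rightarrow> real^'n \<Rightarrow> real^'n \<Rightarrow> real" where
  "bb_step \<alpha>min \<alpha>max B s y =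
     (if s \<bullet> y > 0 then max \<alpha>min (min (s \<bullet> y / (norm_B B s)\<^sup>2) \<alpha>max)
      else if s \<bullet> y < 0 then max \<alpha>min (min (norm y / norm (B *v s)) \<alpha>max)
      else \<alpha>min)"

definition dir_objective ::
    "(real^'n \<Rightarrow> real^'m) \<Rightarrow> ('m \<Rightarrow> real) \<Rightarrow> real^'n^'n \<Rightarrow> real^'n \<Rightarrow> real^'n \<Rightarrow> real" where
  "dir_objective F \<alpha> B x d =
     (MAX i. grad (\<lambda>x. F x $ i) x \<bullet> d / \<alpha> i + 1 / 2 * (norm_B B d)\<^sup>2)"

definition armijo_steps ::
    "(real^'n \<Rightarrow> real^'m) \<Rightarrow> real \<Rightarrow> real \<Rightarrow> real^'n \<Rightarrow> real^'n \<Rightarrow> real set" where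
  "armijo_steps F \<sigma> \<gamma> x d =
     {t \<in> range (\<lambda>j::nat. \<gamma> ^ j).
        \<forall>i. F (x + t *\<^sub>R d) $ i - F x $ i \<le> t * \<sigma> * (grad (\<lambda>x. F x $ i) x \<bullet> d)}"

(* The iterate x^{k-1}, where xm stands for the extra starting point x^{-1}. *)
definition prev_iterate :: "'a \<Rightarrow> (nat \<Rightarrow> 'a) \<Rightarrow> nat \<Rightarrow> 'a" where
  "prev_iterate xm x k = (case k of 0 \<Rightarrow> xm | Suc j \<Rightarrow> x j)"

(* The infinite sequence x is produced by a run that never stops (d k \<noteq> 0 for all k). The matrices
   are arbitrary, since B_{k+1} may be chosen by any rule. *)
definition bbdmo_vm_run ::
    "(real^'n \<Rightarrow> real^'m) \<Rightarrow> real \<Rightarrow> real \<Rightarrow> real \<Rightarrow> real \<Rightarrow> (nat \<Rightarrow> real^'n^'n)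
      \<Rightarrow> real^'n \<Rightarrow> (nat \<Rightarrow> real^'n) \<Rightarrow> bool" where
  "bbdmo_vm_run F \<alpha>min \<alpha>max \<sigma> \<gamma> B xm x \<longleftrightarrow>
     xm \<noteq> x 0 \<and> (\<forall>k. sym_pos_def (B k)) \<and>
     (\<exists>\<alpha> d t. \<forall>k.
        (\<forall>i. \<alpha> k i = bb_step \<alpha>min \<alpha>max (B k) (x k - prev_iterate xm x k)
                (grad (\<lambda>x. F x $ i) (x k) - grad (\<lambda>x. F x $ i) (prev_iterate xm x k))) \<and>
        is_arg_min (dir_objective F (\<alpha> k) (B k) (x k)) (\<lambda>_. True) (d k) \<and>
        d k \<noteq> 0 \<and>
        t k \<in> armijo_steps F \<sigma> \<gamma> (x k) (d k) \<and>
        (\<forall>s \<in> armijo_steps F \<sigma> \<gamma> (x k) (d k). s \<le> t k) \<and>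
        x (Suc k) = x k + t k *\<^sub>R d k)"

definition level_set :: "(real^'n \<Rightarrow> real^'m) \<Rightarrow> real^'n \<Rightarrow> (real^'n) set" where
  "level_set F x0 = {x. \<forall>i. F x $ i \<le> F x0 $ i}"

(* A real-valued supremum: as soon as some component is strongly convex and the weights are
   positive, the set is bounded above, so no infinite value is lost. *)
definition merit_u0 :: "(real^'n \<Rightarrow> real^'m) \<Rightarrow> ('m \<Rightarrow> real) \<Rightarrow> real^'n \<Rightarrow> real" where
  "merit_u0 F w x = (SUP y. MIN i. (F x $ i - F y $ i) / w i)"

definition delta_alpha :: "'m set \<Rightarrow> real \<Rightarrow> ('m \<Rightarrow> real) \<Rightarrow> 'm \<Rightarrow> real" where
  "delta_alpha Lin \<alpha>min \<delta> i = (if i \<in> Lin then \<alpha>min else \<delta> i)"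

(* The constant epsilon. The gradients of the linear components do not depend on the point x0 at
   which they are taken. The hull of finitely many points is compact, so for nonempty Lin the
   infimum is a minimum. *)
definition lin_grad_eps :: "(real^'n \<Rightarrow> real^'m) \<Rightarrow> 'm set \<Rightarrow> real^'n \<Rightarrow> real" where
  "lin_grad_eps F Lin x0 = Inf (norm ` (convex hull ((\<lambda>i. grad (\<lambda>x. F x $ i) x0) ` Lin)))"

(* The constant c. R is the diameter of the level set, which is compact (and the diameter
   attained) when some component is strongly convex. *)
definition rate_c ::
    "(real^'n \<Rightarrow> real^'m) \<Rightarrow> 'm set \<Rightarrow> real \<Rightarrow> real \<Rightarrow> ('m \<Rightarrow> real) \<Rightarrow> ('m \<Rightarrow> real) \<Rightarrow> real^'n \<Rightarrow> real" where
  "rate_c F Lin a b L \<delta> x0 =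
     (1 + b / a) *
     (MAX i\<in>- Lin. (norm (grad (\<lambda>x. F x $ i) x0) + b * L i * diameter (level_set F x0))
                    / (lin_grad_eps F Lin x0 * \<delta> i))"

end

theory Submission
  imports Defs
begin

text \<open>By duality, the direction \<open>d\<close> of an iteration satisfies
  \<open>- (B *v d) = (\<Sum>i. l\<^sub>i *\<^sub>R grad F\<^sub>i x /\<^sub>R \<alpha>\<^sub>i)\<close> with convex weights \<open>l\<close>. The line search decreases
  every \<open>F\<^sub>i / \<alpha>\<^sub>i\<close> by at least \<open>2 * \<gamma> * \<sigma> * (1 - \<sigma>) * min (\<mu>\<^sub>i / L\<^sub>i)\<close> times the squared \<open>B\<close>-norm of \<open>d\<close>,
  while strong convexity, averaged with the weights \<open>l\<close>, bounds the merit function by a multiple of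
  that squared norm. Only nonlinear objectives contribute curvature to this bound; since every convex
  combination of the linear gradients has norm at least \<open>\<epsilon>\<close> and \<open>B *v d\<close> stays bounded, the
  linear objectives have total weight at most \<open>c * \<alpha>min\<close>.

  The iterates converge because the directions tend to zero, so a limit point is critical; its
  multipliers charge some nonlinear objective, and the corresponding weighted sum of the objectives
  grows quadratically around the limit point.\<close>

subsection \<open>Quadratic forms and multipliers\<close>

lemma sym_matrix_dot:
  fixes B :: "real^'n^'n"
  assumes "transpose B = B"
  shows "u \<bullet> (B *v v) = v \<bullet> (B *v u)"
  by (metis assms dot_lmul_matrix inner_commute vector_transpose_matrix)

lemma quadratic_form_add:
  fixes B :: "real^'n^'n"
  assumes "transpose B = B"
  shows "(u + s *\<^sub>R v) \<bullet> (B *v (u + s *\<^sub>R v))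
    = u \<bullet> (B *v u) + 2 * s * (v \<bullet> (B *v u)) + s\<^sup>2 * (v \<bullet> (B *v v))"
  using sym_matrix_dot[OF assms, of u v]
  by (simp add: algebra_simps matrix_vector_right_distrib inner_add_left inner_add_right power2_eq_square)

lemma sym_pos_def_nonneg:
  assumes "sym_pos_def B"
  shows "0 \<le> v \<bullet> (B *v v)"
  using assms unfolding sym_pos_def_def by (cases "v = 0") (auto intro: less_imp_le)

lemma norm_B_sq:
  assumes "sym_pos_def B"
  shows "(norm_B B v)\<^sup>2 = v \<bullet> (B *v v)"
  unfolding norm_B_def using sym_pos_def_nonneg[OF assms] by simp

lemma mat_vector_mult: "mat a *v v = a *\<^sub>R (v :: real^'n)"
  by (simp add: matrix_vector_mult_def mat_def vec_eq_iff if_distrib[of "\<lambda>x. x * _"] cong: if_cong)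

lemma loewner_le_mat_lower:
  assumes "loewner_le (mat a) B"
  shows "a * (norm v)\<^sup>2 \<le> v \<bullet> (B *v v)"
  using assms unfolding loewner_le_def power2_norm_eq_inner
  by (auto simp: matrix_vector_mult_diff_rdistrib mat_vector_mult inner_diff_right)

lemma loewner_le_mat_upper:
  assumes "loewner_le B (mat b)"
  shows "v \<bullet> (B *v v) \<le> b * (norm v)\<^sup>2"
  using assms unfolding loewner_le_def power2_norm_eq_inner
  by (auto simp: matrix_vector_mult_diff_rdistrib mat_vector_mult inner_diff_right)

text \<open>The form of \<open>B\<close> is nonnegative at \<open>v - (1 / b) B v\<close>. Expanding
  there and applying the upper bound \<open>b\<close> to the quadratic terms of both
  \<open>v\<close> and \<open>B v\<close> leaves a comparison of squared norms.\<close>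

lemma norm_matrix_le:
  assumes "sym_pos_def B" and "loewner_le B (mat b)" and "0 < b"
  shows "norm (B *v v) \<le> b * norm v"
proof -
  have s: "transpose B = B"
    using assms(1) by (simp add: sym_pos_def_def)
  let ?w = "B *v v"
  have "0 \<le> v \<bullet> ?w + 2 * (- (1 / b)) * (?w \<bullet> ?w) + (1 / b)\<^sup>2 * (?w \<bullet> (B *v ?w))"
    using sym_pos_def_nonneg[OF assms(1), of "v + (- (1 / b)) *\<^sub>R ?w"]
      quadratic_form_add[OF s, of v "- (1 / b)" ?w] by simp
  also have "\<dots> \<le> b * (norm v)\<^sup>2 + 2 * (- (1 / b)) * (norm ?w)\<^sup>2 + (1 / b)\<^sup>2 * (b * (norm ?w)\<^sup>2)"
    unfolding power2_norm_eq_inner[of ?w, symmetric]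
    by (intro add_mono mult_left_mono[OF loewner_le_mat_upper] loewner_le_mat_upper order_refl assms(2)) simp
  also have "\<dots> = ((b * norm v)\<^sup>2 - (norm ?w)\<^sup>2) / b"
    using assms(3) by (simp add: field_simps power2_eq_square)
  finally have "(norm ?w)\<^sup>2 \<le> (b * norm v)\<^sup>2"
    using assms(3) by (simp add: zero_le_divide_iff)
  then show ?thesis
    using assms(3) by (simp add: power2_le_iff_abs_le)
qed

text \<open>A point outside the compact hull of the \<open>v i\<close> is strictly separated from
  it, and the negated normal is the direction. With \<open>z = 0\<close> this is Gordan's theorem;
  with \<open>z = - (B *v d)\<close> it yields the multipliers of the direction subproblem.\<close>

lemma Gordan_alternative:
  fixes v :: "'m::finite \<Rightarrow> 'a::euclidean_space"
  obtains (multipliers) l where "\<And>i. 0 \<le> l i" "(\<Sum>i\<in>UNIV. l i) = 1" "(\<Sum>i\<in>UNIV. l i *\<^sub>R v i) = z"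
  | (direction) e where "\<And>i. v i \<bullet> e < z \<bullet> e"
proof (cases "z \<in> convex hull (range v)")
  case True
  \<comment> \<open>The weights are indexed by \<open>'m\<close> rather than by points of the range,
    so coinciding \<open>v i\<close> cause no trouble.\<close>
  have "convex hull (range v)
    \<subseteq> {y. \<exists>l. (\<forall>i. 0 \<le> l i) \<and> (\<Sum>i\<in>UNIV. l i) = 1 \<and> (\<Sum>i\<in>UNIV. l i *\<^sub>R v i) = y}" (is "_ \<subseteq> ?C")
  proof (rule hull_minimal)
    show "range v \<subseteq> ?C"
    proof clarsimp
      fix i
      show "\<exists>l. (\<forall>i. 0 \<le> l i) \<and> (\<Sum>i\<in>UNIV. l i) = (1::real) \<and> (\<Sum>i\<in>UNIV. l i *\<^sub>R v i) = v i"
        by (rule exI[of _ "\<lambda>j. if j = i then 1 else 0"])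
          (simp add: if_distrib[of "\<lambda>c. c *\<^sub>R _"] cong: if_cong)
    qed
    show "convex ?C"
    proof (rule convexI, clarsimp)
      fix l m :: "'m \<Rightarrow> real" and s t :: real
      assume a: "0 \<le> s" "0 \<le> t" "s + t = 1" "\<forall>i. 0 \<le> l i" "sum l UNIV = 1"
        "\<forall>i. 0 \<le> m i" "sum m UNIV = 1"
      show "\<exists>n. (\<forall>i. 0 \<le> n i) \<and> sum n UNIV = 1 \<and> (\<Sum>i\<in>UNIV. n i *\<^sub>R v i)
          = s *\<^sub>R (\<Sum>i\<in>UNIV. l i *\<^sub>R v i) + t *\<^sub>R (\<Sum>i\<in>UNIV. m i *\<^sub>R v i)"
        using a by (intro exI[of _ "\<lambda>i. s * l i + t * m i"])
          (simp add: sum.distrib flip: sum_distrib_left scaleR_sum_right,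
           simp add: scaleR_add_left sum.distrib scaleR_sum_right)
    qed
  qed
  then show ?thesis
    using True multipliers by blast
next
  case False
  then obtain e b where "e \<bullet> z < b" "\<And>y. y \<in> convex hull (range v) \<Longrightarrow> b < e \<bullet> y"
    using separating_hyperplane_closed_point[OF convex_convex_hull]
      compact_imp_closed[OF finite_imp_compact_convex_hull[of "range v"]]
    by (metis finite_class.finite_UNIV finite_imageI)
  then have "e \<bullet> z < e \<bullet> v i" for i
    by (meson hull_inc less_trans rangeI)
  then have "v i \<bullet> (- e) < z \<bullet> (- e)" for i
    by (simp add: inner_commute)
  then show ?thesis
    by (rule direction)
qed

text \<open>Both optimality conditions come from competitors of \<open>d\<close>: shrinking
  \<open>d\<close> gives the descent estimate, and moving along a separating direction would
  contradict minimality, so the Gordan alternative must supply multipliers.\<close>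

lemma quadratic_max_minimizer:
  fixes v :: "'m::finite \<Rightarrow> real^'n"
  assumes sym: "transpose B = B" and pos: "\<And>u. 0 \<le> u \<bullet> (B *v u)"
    and min: "\<And>e. (MAX i. v i \<bullet> d + 1/2 * (d \<bullet> (B *v d))) \<le> (MAX i. v i \<bullet> e + 1/2 * (e \<bullet> (B *v e)))"
  shows quadratic_max_minimizer_descent: "v i \<bullet> d \<le> - (d \<bullet> (B *v d))"
    and quadratic_max_minimizer_multipliers: "\<exists>l. (\<forall>i. 0 \<le> l i) \<and> (\<Sum>i\<in>UNIV. l i) = 1 \<and> (\<Sum>i\<in>UNIV. l i *\<^sub>R v i) = - (B *v d)"
proof -
  define q where "q = d \<bullet> (B *v d)"
  define M where "M = (MAX i. v i \<bullet> d)"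
  have q: "0 \<le> q"
    unfolding q_def by (rule pos)
  have M: "v i \<bullet> d \<le> M" for i
    unfolding M_def by (intro Max_ge) auto
  \<comment> \<open>Pointwise form of minimality: for any competitor \<open>e\<close> some index has
    a value at least as large as the optimal one.\<close>
  have K: "\<exists>i. M + q / 2 \<le> v i \<bullet> e + 1/2 * (e \<bullet> (B *v e))" for e
  proof -
    have "M \<in> range (\<lambda>i. v i \<bullet> d)"
      unfolding M_def by (intro Max_in) auto
    then obtain j where "M = v j \<bullet> d"
      by auto
    then have "M + q / 2 \<le> (MAX i. v i \<bullet> d + 1/2 * (d \<bullet> (B *v d)))"
      by (intro Max_ge) (auto simp: q_def)
    also have "\<dots> \<le> (MAX i. v i \<bullet> e + 1/2 * (e \<bullet> (B *v e)))"
      by (rule min)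
    finally have le: "M + q / 2 \<le> (MAX i. v i \<bullet> e + 1/2 * (e \<bullet> (B *v e)))" .
    have "(MAX i. v i \<bullet> e + 1/2 * (e \<bullet> (B *v e))) \<in> range (\<lambda>i. v i \<bullet> e + 1/2 * (e \<bullet> (B *v e)))"
      by (intro Max_in) auto
    then obtain i where "(MAX i. v i \<bullet> e + 1/2 * (e \<bullet> (B *v e))) = v i \<bullet> e + 1/2 * (e \<bullet> (B *v e))"
      by (elim rangeE)
    then show ?thesis
      using le by auto
  qed
  have "M + q \<le> 0"
  proof (rule ccontr)
    assume "\<not> M + q \<le> 0"
    then have h: "0 < M + q"
      by simp
    \<comment> \<open>Replacing \<open>d\<close> by \<open>(1 - s) d\<close> would gain
      \<open>s * (M + q)\<close> and lose only \<open>s^2 * q / 2\<close>; this \<open>s\<close>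
      keeps the gain ahead. The denominator \<open>q + 1\<close> covers
      \<open>q = 0\<close>.\<close>
    define s where "s = min (1/2) ((M + q) / (q + 1))"
    have s: "0 < s" "s < 1" "s \<le> (M + q) / (q + 1)"
      using h q by (auto simp: s_def)
    obtain i where "M + q / 2 \<le> v i \<bullet> ((1 - s) *\<^sub>R d) + 1/2 * (((1 - s) *\<^sub>R d) \<bullet> (B *v ((1 - s) *\<^sub>R d)))"
      using K by blast
    also have "\<dots> = (1 - s) * (v i \<bullet> d) + (1 - s)\<^sup>2 * q / 2"
      by (simp add: q_def matrix_vector_mult_scaleR power2_eq_square)
    also have "\<dots> \<le> (1 - s) * M + (1 - s)\<^sup>2 * q / 2"
      using M s by (simp add: mult_left_mono)
    finally have "s * (M + q) \<le> s * (s * q / 2)"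
      by (simp add: field_simps power2_eq_square)
    then have "M + q \<le> s * q / 2"
      using s by simp
    moreover have "s * (q + 1) \<le> M + q"
      using s q by (simp add: field_simps)
    ultimately have "s * (q + 1) \<le> s * q / 2"
      by linarith
    then have "s * (q / 2 + 1) \<le> 0"
      by (simp add: algebra_simps)
    then show False
      using s q by (simp add: mult_le_0_iff)
  qed
  then show "v i \<bullet> d \<le> - (d \<bullet> (B *v d))"
    using M[of i] unfolding q_def by linarith
  show "\<exists>l. (\<forall>i. 0 \<le> l i) \<and> (\<Sum>i\<in>UNIV. l i) = 1 \<and> (\<Sum>i\<in>UNIV. l i *\<^sub>R v i) = - (B *v d)"
  proof (cases rule: Gordan_alternative[of v "- (B *v d)"])
    case (direction e)
    \<comment> \<open>\<open>\<eta>\<close> is a rate at which all components decrease along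
      \<open>e\<close> at \<open>d\<close>. A step \<open>s\<close> gains at least
      \<open>s * \<eta>\<close> and loses \<open>s^2 * r / 2\<close>, which dictates the choice of
      \<open>s\<close> below.\<close>
    define \<eta> where "\<eta> = - (MAX i. v i \<bullet> e + (B *v d) \<bullet> e)"
    have "(MAX i. v i \<bullet> e + (B *v d) \<bullet> e) \<in> range (\<lambda>i. v i \<bullet> e + (B *v d) \<bullet> e)"
      by (intro Max_in) auto
    then obtain j where "(MAX i. v i \<bullet> e + (B *v d) \<bullet> e) = v j \<bullet> e + (B *v d) \<bullet> e"
      by (elim rangeE)
    then have \<eta>: "0 < \<eta>"
      using direction[of j] by (simp add: \<eta>_def)
    have \<eta>_le: "v i \<bullet> e + (B *v d) \<bullet> e \<le> - \<eta>" for i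
      unfolding \<eta>_def minus_minus by (intro Max_ge) auto
    define r where "r = e \<bullet> (B *v e)"
    have r: "0 \<le> r"
      unfolding r_def by (rule pos)
    define s where "s = \<eta> / (r + 1)"
    have s: "0 < s"
      using \<eta> r by (simp add: s_def)
    obtain i where "M + q / 2 \<le> v i \<bullet> (d + s *\<^sub>R e) + 1/2 * ((d + s *\<^sub>R e) \<bullet> (B *v (d + s *\<^sub>R e)))"
      using K by blast
    also have "\<dots> = v i \<bullet> d + q / 2 + s * (v i \<bullet> e + (B *v d) \<bullet> e) + s\<^sup>2 * r / 2"
      unfolding quadratic_form_add[OF sym] q_def r_def
      by (simp add: inner_add_right inner_commute algebra_simps)
    also have "\<dots> \<le> M + q / 2 + s * (- \<eta>) + s\<^sup>2 * r / 2"
      using M s \<eta>_le by (intro add_mono mult_left_mono order_refl) auto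
    finally have "s * \<eta> \<le> s * (s * r / 2)"
      by (simp add: power2_eq_square)
    then have "\<eta> \<le> s * r / 2"
      using s by simp
    moreover have "s * (r + 1) = \<eta>"
      using r by (simp add: s_def)
    ultimately have "s * (r / 2 + 1) \<le> 0"
      by (simp add: algebra_simps)
    then show ?thesis
      using s r by (simp add: mult_le_0_iff)
  qed blast
qed

subsection \<open>Relative smoothness and the line search\<close>

lemma rel_smoothD:
  "rel_smooth L B h \<Longrightarrow> h y \<le> h x + grad h x \<bullet> (y - x) + L / 2 * (norm_B B (y - x))\<^sup>2"
  unfolding rel_smooth_def by blast

lemma rel_strongly_convexD:
  "rel_strongly_convex \<mu> B h \<Longrightarrow> h x + grad h x \<bullet> (y - x) + \<mu> / 2 * (norm_B B (y - x))\<^sup>2 \<le> h y"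
  unfolding rel_strongly_convex_def by blast

lemma norm_B_diff_commute: "norm_B B (x - y) = norm_B B (y - x)"
proof -
  have "(x - y) \<bullet> (B *v (x - y)) = (y - x) \<bullet> (B *v (y - x))"
    by (simp add: matrix_vector_mult_diff_distrib inner_diff_left inner_diff_right)
  then show ?thesis
    by (simp add: norm_B_def)
qed

lemma grad_affine:
  assumes "\<And>x. h x = g \<bullet> x + \<beta>"
  shows "h differentiable (at x)" and "grad h x = g"
proof -
  have "h = (\<lambda>x. g \<bullet> x + \<beta>)"
    using assms by (simp add: fun_eq_iff)
  then have "GDERIV h x :> g"
    unfolding gderiv_def by (auto intro!: derivative_eq_intros simp: inner_commute)
  then show "h differentiable (at x)" and "grad h x = g"
    by (auto intro: grad_eqI simp: gderiv_def differentiable_def)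
qed

text \<open>The constant zero puts linear objectives under the same two inequalities as the others,
  so later sums can run over all indices at once.\<close>

lemma linear_objective_rel_smooth:
  assumes "linear_objective h"
  shows "rel_smooth 0 B h" and "rel_strongly_convex 0 B h"
proof -
  obtain g \<beta> where h: "\<And>x. h x = g \<bullet> x + \<beta>"
    using assms unfolding linear_objective_def by blast
  show "rel_smooth 0 B h" and "rel_strongly_convex 0 B h"
    unfolding rel_smooth_def rel_strongly_convex_def grad_affine(2)[OF h]
    by (simp_all add: h grad_affine(1)[OF h] inner_diff_right)
qed

lemma linear_objective_grad:
  assumes "linear_objective h"
  shows "grad h x = grad h y"
  using assms grad_affine(2) unfolding linear_objective_def by metis

lemma rel_smooth_curvature_le:
  assumes "rel_smooth L B h"
  shows "(x - y) \<bullet> (grad h x - grad h y) \<le> L * (norm_B B (x - y))\<^sup>2"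
  using rel_smoothD[OF assms, of x y] rel_smoothD[OF assms, of y x]
  by (simp add: norm_B_diff_commute[of B y x] inner_diff_left inner_diff_right inner_commute)

lemma rel_strongly_convex_curvature_ge:
  assumes "rel_strongly_convex \<mu> B h"
  shows "\<mu> * (norm_B B (x - y))\<^sup>2 \<le> (x - y) \<bullet> (grad h x - grad h y)"
  using rel_strongly_convexD[OF assms, of x y] rel_strongly_convexD[OF assms, of y x]
  by (simp add: norm_B_diff_commute[of B y x] inner_diff_left inner_diff_right inner_commute)

text \<open>Strong convexity makes the curvature along \<open>x - y\<close> positive, so the first
  case of \<open>bb_step\<close> applies. Its quotient lies between \<open>\<mu>\<close> and
  \<open>L\<close>, and clipping cannot leave that range because \<open>\<alpha>min \<le> L\<close>
  and \<open>\<mu> \<le> \<alpha>max\<close>.\<close>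

lemma bb_step_bounds:
  assumes "rel_smooth L B h" and "rel_strongly_convex \<mu> B h" and "sym_pos_def B"
    and "x \<noteq> y" and "0 < \<mu>" and "\<alpha>min \<le> L" and "\<mu> \<le> \<alpha>max"
  shows "\<mu> \<le> bb_step \<alpha>min \<alpha>max B (x - y) (grad h x - grad h y)"
    and "bb_step \<alpha>min \<alpha>max B (x - y) (grad h x - grad h y) \<le> L"
proof -
  let ?q = "(x - y) \<bullet> (grad h x - grad h y)"
  have n: "0 < (norm_B B (x - y))\<^sup>2"
    using assms(3,4) unfolding norm_B_sq[OF assms(3)] sym_pos_def_def by simp
  have lo: "\<mu> * (norm_B B (x - y))\<^sup>2 \<le> ?q" and hi: "?q \<le> L * (norm_B B (x - y))\<^sup>2"
    using rel_strongly_convex_curvature_ge rel_smooth_curvature_le assms by blast+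
  have "0 < ?q"
    using lo n assms(5) by (meson less_le_trans mult_pos_pos)
  moreover have "\<mu> \<le> ?q / (norm_B B (x - y))\<^sup>2" "?q / (norm_B B (x - y))\<^sup>2 \<le> L"
    using lo hi n by (simp_all add: pos_le_divide_eq pos_divide_le_eq)
  ultimately show "\<mu> \<le> bb_step \<alpha>min \<alpha>max B (x - y) (grad h x - grad h y)"
    and "bb_step \<alpha>min \<alpha>max B (x - y) (grad h x - grad h y) \<le> L"
    using assms(6,7) unfolding bb_step_def by auto
qed

text \<open>Co-coercivity: the tilted function \<open>z \<mapsto> h z - grad h x \<bullet> z\<close> is minimal at \<open>x\<close>, and a gradient
  step from \<open>y\<close> decreases it by \<open>norm (grad h y - grad h x)\<^sup>2 / (2 * l)\<close>.\<close>
lemma smooth_convex_grad_Lipschitz: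
  assumes smooth: "\<And>x y. h y \<le> h x + grad h x \<bullet> (y - x) + l / 2 * (norm (y - x))\<^sup>2"
    and convex: "\<And>x y. h x + grad h x \<bullet> (y - x) \<le> h y"
    and l: "0 < l"
  shows "norm (grad h y - grad h x) \<le> l * norm (y - x)"
proof -
  define g where "g = grad h y - grad h x"
  define z where "z = y - (1 / l) *\<^sub>R g"
  have "h x + grad h x \<bullet> (z - x) \<le> h z"
    by (rule convex)
  also have "\<dots> \<le> h y + grad h y \<bullet> (z - y) + l / 2 * (norm (z - y))\<^sup>2"
    by (rule smooth)
  also have "l / 2 * (norm (z - y))\<^sup>2 = (norm g)\<^sup>2 / (2 * l)"
    using l by (simp add: z_def power_mult_distrib power_divide power2_eq_square)
  finally have "grad h x \<bullet> (y - x) + (grad h x - grad h y) \<bullet> (z - y) \<le> h y - h x + (norm g)\<^sup>2 / (2 * l)"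
    by (simp add: inner_diff_left inner_diff_right algebra_simps)
  also have "(grad h x - grad h y) \<bullet> (z - y) = (norm g)\<^sup>2 / l"
    unfolding power2_norm_eq_inner by (simp add: z_def g_def inner_diff_left inner_diff_right diff_divide_distrib)
  also have "h y - h x \<le> grad h x \<bullet> (y - x) + l / 2 * (norm (y - x))\<^sup>2"
    using smooth[where x=x and y=y] by simp
  finally have "(norm g)\<^sup>2 / l \<le> l / 2 * (norm (y - x))\<^sup>2 + (norm g)\<^sup>2 / (2 * l)"
    by simp
  then have "(norm g)\<^sup>2 \<le> (l * norm (y - x))\<^sup>2"
    using l by (simp add: field_simps power2_eq_square)
  then show ?thesis
    using l by (simp add: g_def power2_le_iff_abs_le)
qed

text \<open>The upper bound \<open>b\<close> on \<open>B\<close> turns the relative constant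
  \<open>L\<close> into the Euclidean constant \<open>b * L\<close>. This is the source of the term
  \<open>b * L i * diameter\<close> in \<open>rate_c\<close>.\<close>

lemma rel_smooth_convex_grad_Lipschitz:
  assumes "rel_smooth L B h" and "rel_strongly_convex \<mu> B h" and "0 \<le> \<mu>" and "0 < L"
    and "loewner_le B (mat b)" and "sym_pos_def B" and "0 < b"
  shows "norm (grad h y - grad h x) \<le> b * L * norm (y - x)"
proof (rule smooth_convex_grad_Lipschitz)
  fix x y
  have "L / 2 * (norm_B B (y - x))\<^sup>2 \<le> L / 2 * (b * (norm (y - x))\<^sup>2)"
    using loewner_le_mat_upper[OF assms(5)] assms(4) by (intro mult_left_mono) (auto simp: norm_B_sq[OF assms(6)])
  then show "h y \<le> h x + grad h x \<bullet> (y - x) + b * L / 2 * (norm (y - x))\<^sup>2"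
    using rel_smoothD[OF assms(1), of y x] by (simp add: algebra_simps)
  have "0 \<le> \<mu> / 2 * (norm_B B (y - x))\<^sup>2"
    using assms(3) by simp
  then show "h x + grad h x \<bullet> (y - x) \<le> h y"
    using rel_strongly_convexD[OF assms(2), of x y] by linarith
qed (use assms in simp)

text \<open>At a full step \<open>\<sigma>\<close> is the decrease ratio from the Armijo test and
  \<open>1 - 1 / (2 * \<rho>)\<close> the one from smoothness. When the first falls short, the
  surplus of the second, times \<open>2 * \<rho>\<close>, factors as \<open>(1 - 2 * \<sigma> *
  \<rho>) * (2 * (1 - \<sigma>) * \<rho> - 1)\<close> with both factors nonnegative.\<close>

lemma sufficient_decrease_factor:
  fixes \<sigma> \<rho> :: real
  assumes "0 < \<sigma>" "\<sigma> < 1" "0 < \<rho>" "\<rho> \<le> 1"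
  shows "2 * \<sigma> * (1 - \<sigma>) * \<rho> \<le> max \<sigma> (1 - 1 / (2 * \<rho>))"
proof (cases "2 * (1 - \<sigma>) * \<rho> \<le> 1")
  case True
  then have "\<sigma> * (2 * (1 - \<sigma>) * \<rho>) \<le> \<sigma> * 1"
    using assms by (intro mult_left_mono) auto
  then show ?thesis
    by (simp add: algebra_simps)
next
  case False
  then have 1: "0 \<le> 2 * (1 - \<sigma>) * \<rho> - 1"
    by simp
  then have "0 \<le> 1 - 2 * \<sigma> * \<rho>"
    using assms by (simp add: algebra_simps)
  then have "0 \<le> (1 - 2 * \<sigma> * \<rho>) * (2 * (1 - \<sigma>) * \<rho> - 1)"
    using 1 by (rule mult_nonneg_nonneg)
  also have "\<dots> = (1 - 1 / (2 * \<rho>) - 2 * \<sigma> * (1 - \<sigma>) * \<rho>) * (2 * \<rho>)"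
    using assms(3) by (simp add: field_simps)
  finally have "0 \<le> 1 - 1 / (2 * \<rho>) - 2 * \<sigma> * (1 - \<sigma>) * \<rho>"
    using assms(3) by (simp add: zero_le_mult_iff)
  then show ?thesis
    by simp
qed

text \<open>After a backtracking the rejected step bounds \<open>t\<close> from below. The full step \<open>t = 1\<close> may be
  shorter than that bound, and the smoothness inequality then supplies the missing decrease.\<close>
lemma armijo_decrease:
  fixes F :: "real^'n \<Rightarrow> real^'m"
  assumes par: "0 < \<sigma>" "\<sigma> < 1" "0 < \<gamma>" "\<gamma> < 1"
    and t: "t \<in> armijo_steps F \<sigma> \<gamma> x d" "\<And>s. s \<in> armijo_steps F \<sigma> \<gamma> x d \<Longrightarrow> s \<le> t"
    and B: "sym_pos_def B" and d: "d \<noteq> 0"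
    and smooth: "\<And>i. rel_smooth (l i) B (\<lambda>x. F x $ i)" and l: "\<And>i. 0 \<le> l i"
    and descent: "\<And>i. grad (\<lambda>x. F x $ i) x \<bullet> d \<le> - (\<alpha> i * (norm_B B d)\<^sup>2)"
    and \<rho>: "0 < \<rho>" "\<rho> \<le> 1" "\<And>i. \<rho> * l i \<le> \<alpha> i"
  shows "F (x + t *\<^sub>R d) $ i - F x $ i \<le> 2 * \<gamma> * \<sigma> * (1 - \<sigma>) * \<rho> * (grad (\<lambda>x. F x $ i) x \<bullet> d)"
proof -
  define q where "q = (norm_B B d)\<^sup>2"
  define G where "G = (\<lambda>i. grad (\<lambda>x. F x $ i) x \<bullet> d)"
  have q: "0 < q"
    using B d unfolding q_def norm_B_sq[OF B] sym_pos_def_def by simp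
  have G: "G i \<le> - (\<rho> * l i * q)" for i
    using descent[of i] mult_right_mono[OF \<rho>(3)[of i] less_imp_le[OF q]] unfolding G_def q_def by linarith
  have G0: "G i \<le> 0" for i
    using G[of i] mult_nonneg_nonneg[of "\<rho> * l i" q] mult_nonneg_nonneg[of \<rho> "l i"] \<rho>(1) l[of i] q
    by linarith
  have sm: "F (x + s *\<^sub>R d) $ i - F x $ i \<le> s * G i + l i / 2 * s\<^sup>2 * q" for s i
  proof -
    have "(norm_B B (s *\<^sub>R d))\<^sup>2 = s\<^sup>2 * q"
      unfolding q_def norm_B_sq[OF B] by (simp add: matrix_vector_mult_scaleR power2_eq_square)
    then show ?thesis
      using rel_smoothD[OF smooth[of i], of "x + s *\<^sub>R d" x] by (simp add: G_def)
  qed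
  have arm: "F (x + t *\<^sub>R d) $ i - F x $ i \<le> t * \<sigma> * G i"
    using t(1) unfolding armijo_steps_def G_def by blast
  obtain j where j: "t = \<gamma> ^ j"
    using t(1) unfolding armijo_steps_def by blast
  show ?thesis
  proof (cases j)
    case 0
    then have t1: "t = 1"
      using j by simp
    have "2 * \<gamma> * \<sigma> * (1 - \<sigma>) * \<rho> = \<gamma> * (2 * \<sigma> * (1 - \<sigma>) * \<rho>)"
      by simp
    also have "\<dots> \<le> 1 * (2 * \<sigma> * (1 - \<sigma>) * \<rho>)"
      using par \<rho> by (intro mult_right_mono) auto
    also have "\<dots> \<le> max \<sigma> (1 - 1 / (2 * \<rho>))"
      using sufficient_decrease_factor[of \<sigma> \<rho>] par \<rho> by simp
    finally have "max \<sigma> (1 - 1 / (2 * \<rho>)) * G i \<le> 2 * \<gamma> * \<sigma> * (1 - \<sigma>) * \<rho> * G i"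
      using G0 by (intro mult_right_mono_neg)
    moreover have "F (x + t *\<^sub>R d) $ i - F x $ i \<le> \<sigma> * G i"
      using arm t1 by simp
    \<comment> \<open>The bound \<open>G i \<le> - (\<rho> * l i * q)\<close> converts the curvature
      term into a multiple of the slope \<open>G i\<close>.\<close>
    moreover have "l i / 2 * q \<le> - (1 / (2 * \<rho>)) * G i"
      using G[of i] \<rho>(1) by (simp add: field_simps)
    then have "F (x + t *\<^sub>R d) $ i - F x $ i \<le> (1 - 1 / (2 * \<rho>)) * G i"
      using sm[of 1 i] t1 by (simp add: left_diff_distrib)
    ultimately show ?thesis
      unfolding G_def by (simp add: max_def split: if_splits)
  next
    case (Suc j')
    define s where "s = \<gamma> ^ j'"
    have s: "0 < s" "t = \<gamma> * s"
      using par by (simp_all add: s_def j Suc)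
    \<comment> \<open>\<open>s = t / \<gamma>\<close> exceeds \<open>t\<close> and so fails the
      test, possibly in a component \<open>i'\<close> other than \<open>i\<close>. The lower bound
      on \<open>s\<close> drawn from this failure no longer mentions \<open>i'\<close>, so it serves
      every \<open>i\<close>.\<close>
    then have "s \<notin> armijo_steps F \<sigma> \<gamma> x d"
      using t(2)[of s] par by auto
    then obtain i' where "s * \<sigma> * G i' < F (x + s *\<^sub>R d) $ i' - F x $ i'"
      unfolding armijo_steps_def s_def G_def by (auto simp: not_le)
    also have "\<dots> \<le> s * G i' + l i' / 2 * s\<^sup>2 * q"
      by (rule sm)
    finally have "s * ((1 - \<sigma>) * (- G i')) < s * (l i' / 2 * s * q)"
      by (simp add: algebra_simps power2_eq_square)
    then have "(1 - \<sigma>) * (- G i') < l i' / 2 * s * q"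
      using s(1) by (rule mult_left_less_imp_less[OF _ less_imp_le])
    moreover have "(1 - \<sigma>) * (\<rho> * l i' * q) \<le> (1 - \<sigma>) * (- G i')"
      using G[of i'] par by (intro mult_left_mono) auto
    ultimately have "(l i' * q) * (2 * (1 - \<sigma>) * \<rho>) < (l i' * q) * s"
      by (simp add: algebra_simps)
    then have "2 * (1 - \<sigma>) * \<rho> \<le> s"
      using less_imp_le[OF mult_left_less_imp_less] mult_nonneg_nonneg[OF l[of i'] less_imp_le[OF q]] by blast
    then have "\<gamma> * \<sigma> * (2 * (1 - \<sigma>) * \<rho>) \<le> \<gamma> * \<sigma> * s"
      using par by (intro mult_left_mono) auto
    then have "t * \<sigma> * G i \<le> 2 * \<gamma> * \<sigma> * (1 - \<sigma>) * \<rho> * G i"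
      using G0 s(2) by (intro mult_right_mono_neg) (simp_all add: mult_ac)
    then show ?thesis
      using arm unfolding G_def by linarith
  qed
qed

subsection \<open>The merit function and the rate\<close>

text \<open>The minima defining the two sides may be attained at different indices, so they cannot simply be
  multiplied. With \<open>T\<close> and \<open>\<rho>\<close> the minima on the left and on the right, \<open>T \<le> \<rho>^3\<close> and
  \<open>T^2 \<le> (\<delta>\<^sub>i * \<mu>\<^sub>i / L\<^sub>i^2)^3\<close> for every \<open>i\<close>, and the Cauchy-Schwarz inequality combines the two sums
  with the geometric means of their terms.\<close>
lemma rate_inequality:
  fixes S :: "'m::finite set" and l \<alpha> \<delta> \<mu> L w :: "'m \<Rightarrow> real"
  assumes l: "\<And>i. 0 \<le> l i" "(\<Sum>i\<in>UNIV. l i) = 1" and S: "S \<noteq> {}"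
    and ord: "\<And>i. i \<in> S \<Longrightarrow> 0 < \<delta> i \<and> \<delta> i \<le> \<mu> i \<and> \<mu> i \<le> \<alpha> i \<and> \<alpha> i \<le> L i"
    and w: "\<And>i. i \<in> S \<Longrightarrow> w i = \<delta> i" "\<And>i. i \<notin> S \<Longrightarrow> w i = \<alpha> i \<and> 0 < \<alpha> i"
  shows "(\<Sum>i\<in>S. l i) * (MIN i\<in>S. \<mu> i * (\<delta> i)\<^sup>2 / L i ^ 3)
    \<le> (MIN i\<in>S. \<mu> i / L i) * ((\<Sum>i\<in>UNIV. l i * (w i / \<alpha> i)) * (\<Sum>i\<in>S. l i * (\<mu> i / \<alpha> i)))"
proof -
  define T where "T = (MIN i\<in>S. \<mu> i * (\<delta> i)\<^sup>2 / L i ^ 3)"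
  define \<rho> where "\<rho> = (MIN i\<in>S. \<mu> i / L i)"
  define \<Lambda> where "\<Lambda> = (\<Sum>i\<in>S. l i)"
  define P' where "P' = (\<Sum>i\<in>S. l i * (\<delta> i / \<alpha> i))"
  define P where "P = (\<Sum>i\<in>UNIV. l i * (w i / \<alpha> i))"
  define Q where "Q = (\<Sum>i\<in>S. l i * (\<mu> i / \<alpha> i))"
  have pos: "0 < \<delta> i" "0 < \<mu> i" "0 < \<alpha> i" "0 < L i" if "i \<in> S" for i
    using ord[OF that] by linarith+
  have T_le: "T \<le> \<mu> i * (\<delta> i)\<^sup>2 / L i ^ 3" if "i \<in> S" for i
    unfolding T_def using that by (intro Min_le) auto
  have "T \<in> (\<lambda>i. \<mu> i * (\<delta> i)\<^sup>2 / L i ^ 3) ` S"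
    unfolding T_def using S by (intro Min_in) auto
  then obtain i where "i \<in> S" "T = \<mu> i * (\<delta> i)\<^sup>2 / L i ^ 3"
    by auto
  then have T0: "0 < T"
    using pos[of i] by simp
  have "\<rho> \<in> (\<lambda>i. \<mu> i / L i) ` S"
    unfolding \<rho>_def using S by (intro Min_in) auto
  then obtain j where j: "j \<in> S" "\<rho> = \<mu> j / L j"
    by auto
  then have \<rho>0: "0 < \<rho>"
    using pos by simp
  \<comment> \<open>At the index attaining \<open>\<rho>\<close>, replacing
    \<open>\<delta> j\<close> by the larger \<open>\<mu> j\<close> turns the bound on
    \<open>T\<close> into the cube of \<open>\<rho>\<close>.\<close>
  have "\<mu> j * (\<delta> j)\<^sup>2 \<le> \<mu> j * (\<mu> j)\<^sup>2"
    using ord[OF j(1)] by (intro mult_left_mono power_mono) auto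
  then have T_\<rho>: "T \<le> \<rho> ^ 3"
    using T_le[OF j(1)] divide_right_mono[of "\<mu> j * (\<delta> j)\<^sup>2" "\<mu> j * (\<mu> j)\<^sup>2" "L j ^ 3"] pos(4)[OF j(1)]
    unfolding j(2) power_divide by (simp add: power3_eq_cube power2_eq_square mult.assoc)
  \<comment> \<open>The product of \<open>T \<le> \<rho>^3\<close> and
    \<open>T^2 \<le> (r * s)^3\<close> compares cubes, hence
    \<open>T \<le> \<rho> * (r * s)\<close>. Replacing \<open>L i\<close> by the smaller
    \<open>\<alpha> i\<close> only enlarges the right side.\<close>
  have key: "T / \<rho> \<le> \<delta> i / \<alpha> i * (\<mu> i / \<alpha> i)" if i: "i \<in> S" for i
  proof -
    define r where "r = \<delta> i / L i"
    define s where "s = \<mu> i / L i"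
    have rs: "0 < r" "r \<le> s"
      using ord[OF i] pos[OF i] by (auto simp: r_def s_def divide_right_mono)
    have "T \<le> s * r\<^sup>2"
      using T_le[OF i] pos[OF i] by (simp add: r_def s_def power_divide power2_eq_square power3_eq_cube)
    then have "T\<^sup>2 \<le> (s * r\<^sup>2)\<^sup>2"
      using T0 by (intro power_mono) auto
    also have "\<dots> = r ^ 3 * s\<^sup>2 * r"
      by (simp add: power2_eq_square power3_eq_cube)
    also have "\<dots> \<le> r ^ 3 * s\<^sup>2 * s"
      using rs by (intro mult_left_mono) auto
    also have "\<dots> = (r * s) ^ 3"
      by (simp add: power2_eq_square power3_eq_cube)
    finally have "T\<^sup>2 \<le> (r * s) ^ 3" .
    then have "T * T\<^sup>2 \<le> \<rho> ^ 3 * (r * s) ^ 3"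
      using T_\<rho> T0 \<rho>0 by (intro mult_mono) auto
    then have "T ^ 3 \<le> (\<rho> * (r * s)) ^ 3"
      unfolding power_mult_distrib[of \<rho>] by (simp add: power2_eq_square power3_eq_cube mult.assoc)
    moreover have "0 \<le> \<rho> * (r * s)"
      using \<rho>0 rs by simp
    ultimately have "T \<le> \<rho> * (r * s)"
      using power_strict_mono[of "\<rho> * (r * s)" T 3] by (meson not_le zero_less_numeral)
    then have "T / \<rho> \<le> r * s"
      using \<rho>0 by (simp add: field_simps)
    also have "\<dots> \<le> \<delta> i / \<alpha> i * (\<mu> i / \<alpha> i)"
      unfolding r_def s_def using ord[OF i] pos[OF i]
      by (intro mult_mono divide_left_mono) auto
    finally show ?thesis .
  qed
  have \<Lambda>0: "0 \<le> \<Lambda>"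
    unfolding \<Lambda>_def by (intro sum_nonneg l)
  have P'\<Lambda>: "P' \<le> \<Lambda>"
    unfolding P'_def \<Lambda>_def
  proof (rule sum_mono)
    fix i assume i: "i \<in> S"
    then have "\<delta> i / \<alpha> i \<le> 1"
      using ord[OF i] by simp
    then show "l i * (\<delta> i / \<alpha> i) \<le> l i"
      using l(1)[of i] by (rule mult_left_le)
  qed
  \<comment> \<open>Outside \<open>S\<close> the ratio \<open>w i / \<alpha> i\<close> is one, so
    \<open>P\<close> is the remaining weight \<open>1 - \<Lambda>\<close> plus
    \<open>P'\<close>.\<close>
  have "(\<Sum>i\<in>S. l i) + (\<Sum>i\<in>-S. l i) = 1"
    using l(2) sum.Int_Diff[of UNIV l S] by (simp add: Compl_eq_Diff_UNIV)
  moreover have "P = (\<Sum>i\<in>S. l i * (w i / \<alpha> i)) + (\<Sum>i\<in>-S. l i * (w i / \<alpha> i))"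
    using sum.Int_Diff[of UNIV "\<lambda>i. l i * (w i / \<alpha> i)" S] by (simp add: P_def Compl_eq_Diff_UNIV)
  moreover have "(\<Sum>i\<in>S. l i * (w i / \<alpha> i)) = P'"
    unfolding P'_def using w by (intro sum.cong) auto
  moreover have "(\<Sum>i\<in>-S. l i * (w i / \<alpha> i)) = (\<Sum>i\<in>-S. l i)"
  proof (intro sum.cong refl)
    fix i assume "i \<in> - S"
    then show "l i * (w i / \<alpha> i) = l i"
      using w(2)[of i] by simp
  qed
  moreover have "0 \<le> (\<Sum>i\<in>-S. l i)"
    by (intro sum_nonneg l)
  ultimately have P: "P = 1 - \<Lambda> + P'" "\<Lambda> \<le> 1"
    by (simp_all add: \<Lambda>_def)
  have Q0: "0 \<le> Q"
    unfolding Q_def by (intro sum_nonneg mult_nonneg_nonneg l) (use pos in \<open>auto intro: less_imp_le\<close>)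
  have "\<Lambda> * sqrt (T / \<rho>) = (\<Sum>i\<in>S. l i * sqrt (T / \<rho>))"
    by (simp add: \<Lambda>_def sum_distrib_right)
  also have "\<dots> \<le> (\<Sum>i\<in>S. l i * sqrt (\<delta> i / \<alpha> i * (\<mu> i / \<alpha> i)))"
    by (intro sum_mono mult_left_mono real_sqrt_le_mono key l)
  also have "\<dots> = (\<Sum>i\<in>S. sqrt (l i * (\<delta> i / \<alpha> i)) * sqrt (l i * (\<mu> i / \<alpha> i)))"
  proof (intro sum.cong refl)
    fix i
    have "sqrt (l i * (\<delta> i / \<alpha> i)) * sqrt (l i * (\<mu> i / \<alpha> i))
      = sqrt ((l i)\<^sup>2 * (\<delta> i / \<alpha> i * (\<mu> i / \<alpha> i)))"
      by (simp add: real_sqrt_mult[symmetric] power2_eq_square mult_ac)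
    also have "\<dots> = l i * sqrt (\<delta> i / \<alpha> i * (\<mu> i / \<alpha> i))"
      using l(1)[of i] by (simp only: real_sqrt_mult real_sqrt_abs abs_of_nonneg)
    finally show "l i * sqrt (\<delta> i / \<alpha> i * (\<mu> i / \<alpha> i))
      = sqrt (l i * (\<delta> i / \<alpha> i)) * sqrt (l i * (\<mu> i / \<alpha> i))" ..
  qed
  finally have "(\<Lambda> * sqrt (T / \<rho>))\<^sup>2 \<le> (\<Sum>i\<in>S. sqrt (l i * (\<delta> i / \<alpha> i)) * sqrt (l i * (\<mu> i / \<alpha> i)))\<^sup>2"
    using \<Lambda>0 T0 \<rho>0 by (intro power_mono) auto
  also have "\<dots> \<le> (\<Sum>i\<in>S. (sqrt (l i * (\<delta> i / \<alpha> i)))\<^sup>2) * (\<Sum>i\<in>S. (sqrt (l i * (\<mu> i / \<alpha> i)))\<^sup>2)"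
    by (rule Cauchy_Schwarz_ineq_sum)
  also have "\<dots> = P' * Q"
    unfolding P'_def Q_def using l pos
    by (intro arg_cong2[where f="(*)"] sum.cong refl real_sqrt_pow2)
      (auto intro!: mult_nonneg_nonneg divide_nonneg_nonneg intro: less_imp_le)
  finally have "\<Lambda>\<^sup>2 * (T / \<rho>) \<le> P' * Q"
    using T0 \<rho>0 by (simp add: power_mult_distrib)
  also have "P' \<le> \<Lambda> * P"
  proof -
    \<comment> \<open>This product equals \<open>\<Lambda> * P - P'\<close>; the extra factor
      \<open>\<Lambda>\<close> later cancels against the square in the Cauchy-Schwarz bound.\<close>
    have "0 \<le> (1 - \<Lambda>) * (\<Lambda> - P')"
      using P'\<Lambda> P(2) by simp
    then show ?thesis
      unfolding P(1) by (simp add: algebra_simps)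
  qed
  then have "P' * Q \<le> \<Lambda> * P * Q"
    using Q0 by (rule mult_right_mono)
  finally have main: "\<Lambda> * (\<Lambda> * (T / \<rho>)) \<le> \<Lambda> * (P * Q)"
    by (simp add: power2_eq_square mult_ac)
  have "\<Lambda> * (T / \<rho>) \<le> P * Q"
  proof (cases "\<Lambda> = 0")
    case True
    then have "P' = 0"
      unfolding P'_def using l sum_nonneg_eq_0_iff[of S l] by (simp add: \<Lambda>_def)
    then show ?thesis
      using True Q0 P by simp
  next
    case False
    then have "0 < \<Lambda>"
      using \<Lambda>0 by simp
    then show ?thesis
      using main unfolding mult_le_cancel_left_pos[OF \<open>0 < \<Lambda>\<close>] by simp
  qed
  then have "\<Lambda> * T \<le> \<rho> * (P * Q)"
    using \<rho>0 by (simp add: field_simps)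
  then show ?thesis
    unfolding \<Lambda>_def T_def \<rho>_def P_def Q_def .
qed

text \<open>Averaging the strong convexity inequalities with weights \<open>l i / \<alpha> i\<close>
  and inserting \<open>dual\<close> bounds the gap by a concave quadratic in \<open>y - x\<close>.
  Nonnegativity of the form at \<open>d - Q (y - x)\<close> completes the square. Multiplying by
  \<open>2 * Q\<close> avoids a division, since \<open>Q\<close> may vanish.\<close>

lemma merit_gap_le_direction:
  fixes F :: "real^'n \<Rightarrow> real^'m" and l \<alpha> \<nu> w :: "'m \<Rightarrow> real"
  assumes B: "sym_pos_def B" and l: "\<And>i. 0 \<le> l i"
    and pos: "\<And>i. 0 < w i" "\<And>i. 0 < \<alpha> i" "\<And>i. 0 \<le> \<nu> i"
    and sc: "\<And>i. rel_strongly_convex (\<nu> i) B (\<lambda>x. F x $ i)"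
    and dual: "(\<Sum>i\<in>UNIV. l i *\<^sub>R (grad (\<lambda>x. F x $ i) x /\<^sub>R \<alpha> i)) = - (B *v d)"
  shows "(MIN i. (F x $ i - F y $ i) / w i)
    * (2 * ((\<Sum>i\<in>UNIV. l i * (w i / \<alpha> i)) * (\<Sum>i\<in>UNIV. l i * (\<nu> i / \<alpha> i)))) \<le> (norm_B B d)\<^sup>2"
proof -
  define m where "m = (MIN i. (F x $ i - F y $ i) / w i)"
  define P where "P = (\<Sum>i\<in>UNIV. l i * (w i / \<alpha> i))"
  define Q where "Q = (\<Sum>i\<in>UNIV. l i * (\<nu> i / \<alpha> i))"
  define v where "v = y - x"
  define n where "n = (norm_B B v)\<^sup>2"
  have sym: "transpose B = B"
    using B by (simp add: sym_pos_def_def)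
  have Q0: "0 \<le> Q"
    unfolding Q_def by (intro sum_nonneg mult_nonneg_nonneg divide_nonneg_nonneg l) (simp_all add: pos less_imp_le)
  have "m * P = (\<Sum>i\<in>UNIV. l i / \<alpha> i * (w i * m))"
    by (simp add: P_def sum_distrib_left mult_ac)
  also have "\<dots> \<le> (\<Sum>i\<in>UNIV. l i / \<alpha> i * - (grad (\<lambda>x. F x $ i) x \<bullet> v + \<nu> i / 2 * n))"
  proof (intro sum_mono mult_left_mono)
    fix i
    have "m \<le> (F x $ i - F y $ i) / w i"
      unfolding m_def by (intro Min_le) auto
    then have "w i * m \<le> F x $ i - F y $ i"
      using pos(1)[of i] by (simp add: pos_le_divide_eq mult.commute)
    also have "\<dots> \<le> - (grad (\<lambda>x. F x $ i) x \<bullet> v + \<nu> i / 2 * n)"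
      using rel_strongly_convexD[OF sc[of i], of x y] by (simp add: v_def n_def)
    finally show "w i * m \<le> - (grad (\<lambda>x. F x $ i) x \<bullet> v + \<nu> i / 2 * n)" .
    show "0 \<le> l i / \<alpha> i"
      using l[of i] pos(2)[of i] by simp
  qed
  also have "\<dots> = (\<Sum>i\<in>UNIV. - ((l i *\<^sub>R (grad (\<lambda>x. F x $ i) x /\<^sub>R \<alpha> i)) \<bullet> v) - n / 2 * (l i * (\<nu> i / \<alpha> i)))"
    using less_imp_neq[OF pos(2), THEN not_sym] by (intro sum.cong refl) (simp add: field_simps)
  also have "\<dots> = - ((\<Sum>i\<in>UNIV. l i *\<^sub>R (grad (\<lambda>x. F x $ i) x /\<^sub>R \<alpha> i)) \<bullet> v) - n / 2 * Q"
    unfolding Q_def inner_sum_left sum_distrib_left sum_subtractf sum_negf ..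
  also have "\<dots> = v \<bullet> (B *v d) - n / 2 * Q"
    unfolding dual by (simp add: inner_commute)
  finally have "(m * P) * (2 * Q) \<le> (v \<bullet> (B *v d) - n / 2 * Q) * (2 * Q)"
    using Q0 by (intro mult_right_mono) auto
  moreover have "0 \<le> d \<bullet> (B *v d) + 2 * (- Q) * (v \<bullet> (B *v d)) + (- Q)\<^sup>2 * n"
    using sym_pos_def_nonneg[OF B, of "d + (- Q) *\<^sub>R v"] quadratic_form_add[OF sym, of d "- Q" v]
    by (simp add: n_def norm_B_sq[OF B])
  ultimately have "m * (2 * (P * Q)) \<le> (norm_B B d)\<^sup>2"
    unfolding norm_B_sq[OF B] by (simp add: algebra_simps power2_eq_square)
  then show ?thesis
    unfolding m_def P_def Q_def .
qed

lemma quadratic_lower_bound: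
  fixes g v :: "'a::real_inner"
  assumes "0 < c"
  shows "- ((norm g)\<^sup>2 / (2 * c)) \<le> g \<bullet> v + c / 2 * (norm v)\<^sup>2"
proof -
  have "0 \<le> (norm (g + c *\<^sub>R v))\<^sup>2 / (2 * c)"
    using assms by simp
  also have "\<dots> = (norm g)\<^sup>2 / (2 * c) + (g \<bullet> v + c / 2 * (norm v)\<^sup>2)"
    using assms unfolding power2_norm_eq_inner
    by (simp add: inner_add_left inner_add_right inner_commute field_simps power2_eq_square)
  finally show ?thesis
    by simp
qed

lemma rel_strongly_convex_norm:
  assumes "rel_strongly_convex \<mu> B h" "sym_pos_def B" "loewner_le (mat a) B" "0 \<le> \<mu>"
  shows "h x + grad h x \<bullet> (y - x) + \<mu> * a / 2 * (norm (y - x))\<^sup>2 \<le> h y"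
  using rel_strongly_convexD[OF assms(1), of x y]
    mult_left_mono[OF loewner_le_mat_lower[OF assms(3), of "y - x"], of "\<mu> / 2"] assms(4)
  by (simp add: norm_B_sq[OF assms(2)])

text \<open>The real supremum in \<open>merit_u0\<close> is informative only over a bounded set. One
  strongly convex component suffices: the minimum is at most its term, which a completed square
  bounds.\<close>

lemma merit_bdd_above:
  fixes F :: "real^'n \<Rightarrow> real^'m"
  assumes "rel_strongly_convex \<mu> B (\<lambda>x. F x $ i)" "sym_pos_def B" "loewner_le (mat a) B" "0 < \<mu>" "0 < a"
    and w: "0 < w i"
  shows "bdd_above (range (\<lambda>y. MIN i. (F x $ i - F y $ i) / w i))"
proof (rule bdd_aboveI2)
  fix y
  have c: "0 < \<mu> * a"
    using assms by simp
  have "(MIN i. (F x $ i - F y $ i) / w i) \<le> (F x $ i - F y $ i) / w i"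
    by (intro Min_le) auto
  also have "\<dots> \<le> (norm (grad (\<lambda>x. F x $ i) x))\<^sup>2 / (2 * (\<mu> * a)) / w i"
    using rel_strongly_convex_norm[OF assms(1,2,3), of x y] assms(4) w
      quadratic_lower_bound[OF c, of "grad (\<lambda>x. F x $ i) x" "y - x"]
    by (intro divide_right_mono) auto
  finally show "(MIN i. (F x $ i - F y $ i) / w i) \<le> (norm (grad (\<lambda>x. F x $ i) x))\<^sup>2 / (2 * (\<mu> * a)) / w i" .
qed

lemma merit_nonneg:
  assumes "bdd_above (range (\<lambda>y. MIN i. (F x $ i - F y $ i) / w i))"
  shows "0 \<le> merit_u0 F w x"
  unfolding merit_u0_def using cSUP_upper[OF UNIV_I assms, of x] by simp

text \<open>Dividing by \<open>w i\<close> turns the component decreases into the same drop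
  \<open>\<eta>\<close>. For each \<open>y\<close> the index attaining the minimum at
  \<open>x\<close> is also tested at \<open>z\<close>.\<close>

lemma merit_decrease:
  assumes bdd: "bdd_above (range (\<lambda>y. MIN i. (F x $ i - F y $ i) / w i))"
    and w: "\<And>i. 0 < w i" and dec: "\<And>i. F z $ i \<le> F x $ i - w i * \<eta>"
  shows "merit_u0 F w z \<le> merit_u0 F w x - \<eta>"
  unfolding merit_u0_def[of F w z]
proof (rule cSUP_least)
  fix y
  have "(MIN i. (F x $ i - F y $ i) / w i) \<in> range (\<lambda>i. (F x $ i - F y $ i) / w i)"
    by (intro Min_in) auto
  then obtain i where i: "(MIN i. (F x $ i - F y $ i) / w i) = (F x $ i - F y $ i) / w i"
    by (elim rangeE)
  have "(MIN i. (F z $ i - F y $ i) / w i) \<le> (F z $ i - F y $ i) / w i"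
    by (intro Min_le) auto
  also have "\<dots> \<le> (F x $ i - w i * \<eta> - F y $ i) / w i"
    using dec[of i] w[of i] by (intro divide_right_mono) auto
  also have "\<dots> = (F x $ i - F y $ i) / w i - \<eta>"
    using less_imp_neq[OF w[of i]] by (simp add: diff_divide_distrib)
  also have "\<dots> \<le> merit_u0 F w x - \<eta>"
    unfolding merit_u0_def i[symmetric] using cSUP_upper[OF UNIV_I bdd] by simp
  finally show "(MIN i. (F z $ i - F y $ i) / w i) \<le> merit_u0 F w x - \<eta>" .
qed simp

text \<open>The product form admits \<open>c = 0\<close>, where only the sign of \<open>q\<close>
  matters.\<close>

lemma merit_le_direction:
  assumes "\<And>y. (MIN i. (F x $ i - F y $ i) / w i) * c \<le> q" and "0 \<le> c" "0 \<le> q"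
  shows "merit_u0 F w x * c \<le> q"
proof (cases "c = 0")
  case False
  then have c: "0 < c"
    using assms(2) by simp
  have "merit_u0 F w x \<le> q / c"
    unfolding merit_u0_def
    by (rule cSUP_least) (use assms(1) c in \<open>simp_all add: pos_le_divide_eq\<close>)
  then show ?thesis
    using c by (simp add: pos_le_divide_eq)
qed (use assms in simp)

text \<open>In the dual equation the linear gradients are divided by \<open>\<alpha>min\<close>, so
  their weighted sum \<open>s\<close> is \<open>\<alpha>min\<close> times a vector of norm at most
  \<open>(1 + b / a) * M\<close>. Divided by its total weight, \<open>s\<close> lies in the hull,
  where norms are at least \<open>\<epsilon>\<close>.\<close>

lemma linear_weight_le:
  fixes g :: "'m::finite \<Rightarrow> real^'n" and l \<alpha> :: "'m \<Rightarrow> real"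
  assumes \<alpha>min: "0 < \<alpha>min" and l: "\<And>i. 0 \<le> l i" "(\<Sum>i\<in>UNIV. l i) = 1"
    and dual: "(\<Sum>i\<in>UNIV. l i *\<^sub>R (g i /\<^sub>R \<alpha> i)) = - (B *v d)"
    and \<alpha>: "\<And>i. 0 < \<alpha> i" "\<And>i. i \<in> Lin \<Longrightarrow> \<alpha> i = \<alpha>min"
    and M: "\<And>i. i \<notin> Lin \<Longrightarrow> norm (g i) \<le> M * \<alpha> i" "- Lin \<noteq> {}"
    and descent: "\<And>i. g i \<bullet> d \<le> - (\<alpha> i * (d \<bullet> (B *v d)))"
    and B: "a * (norm d)\<^sup>2 \<le> d \<bullet> (B *v d)" "norm (B *v d) \<le> b * norm d" and ab: "0 < a" "0 < b"
    and \<epsilon>: "\<And>v. v \<in> convex hull (g ` Lin) \<Longrightarrow> \<epsilon> \<le> norm v"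
  shows "(\<Sum>i\<in>Lin. l i) * \<epsilon> \<le> \<alpha>min * ((1 + b / a) * M)"
proof -
  obtain i0 where i0: "i0 \<notin> Lin"
    using M(2) by blast
  have "0 \<le> M * \<alpha> i0"
    using M(1)[OF i0] norm_ge_zero order_trans by blast
  then have M0: "0 \<le> M"
    using \<alpha>(1)[of i0] by (simp add: zero_le_mult_iff)
  show ?thesis
  proof (cases "(\<Sum>i\<in>Lin. l i) = 0")
    case nz: False
    define \<Lambda> where "\<Lambda> = (\<Sum>i\<in>Lin. l i)"
    have \<Lambda>: "0 < \<Lambda>"
      using nz sum_nonneg[of Lin l] l(1) by (simp add: \<Lambda>_def less_le)
    \<comment> \<open>At the nonlinear index \<open>i0\<close> the descent estimate is quadratic in
      \<open>norm d\<close> while Cauchy-Schwarz is linear.\<close>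
    have d: "norm d \<le> M / a"
    proof (cases "d = 0")
      case False
      have "\<alpha> i0 * (a * (norm d)\<^sup>2) \<le> \<alpha> i0 * (d \<bullet> (B *v d))"
        using B(1) \<alpha>(1)[of i0] by (intro mult_left_mono) auto
      also have "\<dots> \<le> \<bar>g i0 \<bullet> d\<bar>"
        using descent[of i0] by linarith
      also have "\<dots> \<le> norm (g i0) * norm d"
        by (rule Cauchy_Schwarz_ineq2)
      also have "\<dots> \<le> M * \<alpha> i0 * norm d"
        using M(1)[OF i0] by (intro mult_right_mono) auto
      finally have "(\<alpha> i0 * norm d) * (a * norm d) \<le> (\<alpha> i0 * norm d) * M"
        by (simp add: power2_eq_square mult_ac)
      then have "a * norm d \<le> M"
        using False \<alpha>(1)[of i0] by simp
      then show ?thesis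
        using ab by (simp add: pos_le_divide_eq mult.commute)
    qed (use M0 ab in simp)
    define s where "s = (\<Sum>i\<in>Lin. l i *\<^sub>R g i)"
    define r where "r = (\<Sum>i\<in>-Lin. l i *\<^sub>R (g i /\<^sub>R \<alpha> i))"
    have "(\<Sum>i\<in>Lin. l i *\<^sub>R (g i /\<^sub>R \<alpha> i)) = s /\<^sub>R \<alpha>min"
      using \<alpha>(2) by (simp add: s_def scaleR_sum_right mult.commute cong: sum.cong)
    then have "s /\<^sub>R \<alpha>min + r = - (B *v d)"
      using dual sum.Int_Diff[of UNIV "\<lambda>i. l i *\<^sub>R (g i /\<^sub>R \<alpha> i)" Lin] by (simp add: r_def Compl_eq_Diff_UNIV)
    then have "s /\<^sub>R \<alpha>min = - (B *v d) - r"
      by (simp add: eq_diff_eq)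
    then have s: "s = \<alpha>min *\<^sub>R (- (B *v d) - r)"
      using \<alpha>min by (metis less_irrefl scaleR_one scaleR_scaleR right_inverse)
    have "norm r \<le> (\<Sum>i\<in>-Lin. l i * M)"
      unfolding r_def
    proof (rule sum_norm_le)
      fix i assume "i \<in> - Lin"
      then have "norm (g i) / \<alpha> i \<le> M"
        using M(1)[of i] \<alpha>(1)[of i] by (simp add: pos_divide_le_eq)
      then have "l i * (norm (g i) / \<alpha> i) \<le> l i * M"
        using l(1) by (rule mult_left_mono)
      then show "norm (l i *\<^sub>R (g i /\<^sub>R \<alpha> i)) \<le> l i * M"
        using l(1)[of i] \<alpha>(1)[of i] by (simp add: divide_inverse mult_ac)
    qed
    also have "\<dots> \<le> (\<Sum>i\<in>UNIV. l i * M)"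
      using l M0 by (intro sum_mono2) auto
    also have "\<dots> = M"
      using l(2) by (simp add: sum_distrib_right[symmetric])
    finally have r: "norm r \<le> M" .
    have "norm (- (B *v d) - r) \<le> norm (B *v d) + norm r"
      by (metis norm_minus_cancel norm_triangle_ineq4)
    also have "\<dots> \<le> b * (M / a) + M"
      using B(2) r d mult_left_mono[OF d, of b] ab by linarith
    finally have "norm (- (B *v d) - r) \<le> (1 + b / a) * M"
      by (simp add: algebra_simps)
    then have ns: "norm s \<le> \<alpha>min * ((1 + b / a) * M)"
      unfolding s norm_scaleR using \<alpha>min by (simp add: mult_left_mono)
    have "(\<Sum>i\<in>Lin. (l i / \<Lambda>) *\<^sub>R g i) \<in> convex hull (g ` Lin)"
      using l(1) \<Lambda> by (intro convex_sum) (auto intro: hull_inc simp: sum_divide_distrib[symmetric] \<Lambda>_def)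
    then have "\<epsilon> \<le> norm (\<Sum>i\<in>Lin. (l i / \<Lambda>) *\<^sub>R g i)"
      by (rule \<epsilon>)
    also have "(\<Sum>i\<in>Lin. (l i / \<Lambda>) *\<^sub>R g i) = s /\<^sub>R \<Lambda>"
      by (simp add: s_def scaleR_sum_right divide_inverse mult.commute)
    finally have "\<Lambda> * \<epsilon> \<le> norm s"
      using \<Lambda> by (simp add: field_simps)
    then show ?thesis
      using ns unfolding \<Lambda>_def by linarith
  qed (use M0 \<alpha>min ab in simp)
qed

subsection \<open>Convergence of the iterates\<close>

lemma tendsto_if_norm_sq_diff_le:
  fixes f :: "'b \<Rightarrow> 'a::real_normed_vector"
  assumes "\<And>k. (norm (f k - a))\<^sup>2 \<le> g k" and "(g \<longlongrightarrow> 0) net"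
  shows "(f \<longlongrightarrow> a) net"
proof -
  have "((\<lambda>k. (norm (f k - a))\<^sup>2) \<longlongrightarrow> 0) net"
    by (rule tendsto_sandwich[OF _ _ tendsto_const assms(2)]) (simp_all add: assms(1))
  then have "((\<lambda>k. sqrt ((norm (f k - a))\<^sup>2)) \<longlongrightarrow> sqrt 0) net"
    by (rule tendsto_real_sqrt)
  then show ?thesis
    by (simp add: LIM_zero_iff tendsto_norm_zero_iff)
qed

text \<open>The monotone objective values converge to those at a cluster point \<open>xs\<close>,
  and the vanishing gaps force \<open>d\<close> to zero. A common descent direction \<open>e\<close>
  at \<open>xs\<close> would keep \<open>(B k *v d k) \<bullet> e\<close>, an average of negated
  slopes, away from zero along the subsequence.\<close>

lemma critical_limit_point:
  fixes F :: "real^'n \<Rightarrow> real^'m" and x d :: "nat \<Rightarrow> real^'n" and l \<alpha> :: "nat \<Rightarrow> 'm \<Rightarrow> real"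
  assumes F: "continuously_diff F" and bdd: "bounded (range x)"
    and dec: "\<And>k i. F (x (Suc k)) $ i \<le> F (x k) $ i - c * (norm (d k))\<^sup>2" and c: "0 < c"
    and l: "\<And>k i. 0 \<le> l k i" "\<And>k. (\<Sum>i\<in>UNIV. l k i) = 1"
    and dual: "\<And>k. (\<Sum>i\<in>UNIV. l k i *\<^sub>R (grad (\<lambda>x. F x $ i) (x k) /\<^sub>R \<alpha> k i)) = - (B k *v d k)"
    and B: "\<And>k v. norm (B k *v v) \<le> b * norm v"
    and \<alpha>: "\<And>k i. 0 < \<alpha> k i" "\<And>k i. \<alpha> k i \<le> A"
  obtains xs where "pareto_critical F xs" "\<And>i. (\<lambda>k. F (x k) $ i) \<longlonglongrightarrow> F xs $ i"
proof -
  obtain xs r where r: "strict_mono r" "(x \<circ> r) \<longlonglongrightarrow> xs"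
    using bounded_imp_convergent_subsequence[OF bdd] by auto
  have cont: "isCont (\<lambda>x. F x $ i) xs" "isCont (grad (\<lambda>x. F x $ i)) xs" for i
    using F unfolding continuously_diff_def
    by (auto simp: continuous_on_eq_continuous_at intro: differentiable_imp_continuous_within)
  have decF: "decseq (\<lambda>k. F (x k) $ i)" for i
  proof (rule decseq_SucI)
    fix k
    have "0 \<le> c * (norm (d k))\<^sup>2"
      using c by simp
    then show "F (x (Suc k)) $ i \<le> F (x k) $ i"
      using dec[of k i] by linarith
  qed
  have lim: "(\<lambda>k. F (x k) $ i) \<longlonglongrightarrow> F xs $ i" for i
  proof -
    have sub: "(\<lambda>k. F (x (r k)) $ i) \<longlonglongrightarrow> F xs $ i"
      using isCont_tendsto_compose[OF cont(1) r(2)] by (simp add: o_def)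
    have "decseq (\<lambda>k. F (x (r k)) $ i)"
      using decF[of i] r(1) by (simp add: decseq_def strict_mono_less_eq)
    then have "F xs $ i \<le> F (x (r k)) $ i" for k
      using decseq_ge sub by blast
    moreover have "F (x (r k)) $ i \<le> F (x k) $ i" for k
      using decF[of i] seq_suble[OF r(1), of k] by (simp add: decseq_def)
    ultimately have "F xs $ i \<le> F (x k) $ i" for k
      using order_trans by blast
    then obtain L where L: "(\<lambda>k. F (x k) $ i) \<longlonglongrightarrow> L"
      using decseq_convergent[OF decF] by metis
    then have "(\<lambda>k. F (x (r k)) $ i) \<longlonglongrightarrow> L"
      using LIMSEQ_subseq_LIMSEQ[OF L r(1)] by (simp add: o_def)
    then show ?thesis
      using sub L LIMSEQ_unique by blast
  qed
  obtain i0 :: 'm where True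
    by blast
  have "(\<lambda>k. (F (x k) $ i0 - F (x (Suc k)) $ i0) / c) \<longlonglongrightarrow> (F xs $ i0 - F xs $ i0) / c"
    using c by (intro tendsto_intros lim LIMSEQ_Suc) auto
  then have gap: "(\<lambda>k. (F (x k) $ i0 - F (x (Suc k)) $ i0) / c) \<longlonglongrightarrow> 0"
    by simp
  have "(norm (d k))\<^sup>2 \<le> (F (x k) $ i0 - F (x (Suc k)) $ i0) / c" for k
    using dec[of k i0] c by (simp add: pos_le_divide_eq mult.commute)
  then have "d \<longlonglongrightarrow> 0"
    by (intro tendsto_if_norm_sq_diff_le[OF _ gap, where a=0]) simp
  then have d0: "(\<lambda>k. norm (d k)) \<longlonglongrightarrow> 0"
    by (rule tendsto_norm_zero)
  have "pareto_critical F xs"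
    unfolding pareto_critical_def
  proof (rule notI, elim exE)
    fix e assume e: "\<forall>i. grad (\<lambda>x. F x $ i) xs \<bullet> e < 0"
    \<comment> \<open>Half of the smallest descent rate, so that continuity preserves the bound near
      \<open>xs\<close>.\<close>
    define \<eta> where "\<eta> = - (MAX i. grad (\<lambda>x. F x $ i) xs \<bullet> e) / 2"
    have "(MAX i. grad (\<lambda>x. F x $ i) xs \<bullet> e) \<in> range (\<lambda>i. grad (\<lambda>x. F x $ i) xs \<bullet> e)"
      by (intro Max_in) auto
    then have \<eta>: "0 < \<eta>"
      using e by (auto simp: \<eta>_def)
    have le: "grad (\<lambda>x. F x $ i) xs \<bullet> e \<le> (MAX i. grad (\<lambda>x. F x $ i) xs \<bullet> e)" for i
      by (intro Max_ge) auto
    have lt: "grad (\<lambda>x. F x $ i) xs \<bullet> e < - \<eta>" for i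
      using le[of i] \<eta> unfolding \<eta>_def by linarith
    have "\<forall>\<^sub>F k in sequentially. grad (\<lambda>x. F x $ i) (x (r k)) \<bullet> e < - \<eta>" for i
    proof -
      have "(\<lambda>k. grad (\<lambda>x. F x $ i) (x (r k)) \<bullet> e) \<longlonglongrightarrow> grad (\<lambda>x. F x $ i) xs \<bullet> e"
        using isCont_tendsto_compose[OF cont(2) r(2)] by (intro tendsto_intros) (simp add: o_def)
      then show ?thesis
        using lt order_tendstoD(2) by blast
    qed
    then have ev1: "\<forall>\<^sub>F k in sequentially. \<forall>i. grad (\<lambda>x. F x $ i) (x (r k)) \<bullet> e < - \<eta>"
      by (simp add: eventually_all_finite)
    have A: "0 < A"
      using less_le_trans[OF \<alpha>(1) \<alpha>(2)] .
    have "(\<lambda>k. b * norm (d (r k)) * norm e) \<longlonglongrightarrow> b * 0 * norm e"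
      using LIMSEQ_subseq_LIMSEQ[OF d0 r(1)] by (intro tendsto_intros) (simp add: o_def)
    then have ev2: "\<forall>\<^sub>F k in sequentially. b * norm (d (r k)) * norm e < \<eta> / A"
      using \<eta> A by (intro order_tendstoD(2)) auto
    obtain k where k: "\<And>i. grad (\<lambda>x. F x $ i) (x (r k)) \<bullet> e < - \<eta>"
      "b * norm (d (r k)) * norm e < \<eta> / A"
      using eventually_happens'[OF _ eventually_conj[OF ev1 ev2]] by auto
    have "\<eta> / A = (\<Sum>i\<in>UNIV. l (r k) i * (\<eta> / A))"
      using l(2) by (simp add: sum_distrib_right[symmetric] del: times_divide_eq_right)
    also have "\<dots> \<le> (\<Sum>i\<in>UNIV. l (r k) i * - ((grad (\<lambda>x. F x $ i) (x (r k)) /\<^sub>R \<alpha> (r k) i) \<bullet> e))"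
    proof (intro sum_mono mult_left_mono l)
      fix i
      have "\<eta> / A \<le> \<eta> / \<alpha> (r k) i"
        using \<alpha>[of "r k" i] \<eta> A by (intro divide_left_mono) auto
      also have "\<dots> \<le> (- (grad (\<lambda>x. F x $ i) (x (r k)) \<bullet> e)) / \<alpha> (r k) i"
        using k(1)[of i] \<alpha>(1)[of "r k" i] by (intro divide_right_mono) auto
      finally show "\<eta> / A \<le> - ((grad (\<lambda>x. F x $ i) (x (r k)) /\<^sub>R \<alpha> (r k) i) \<bullet> e)"
        by (simp add: divide_inverse mult.commute)
    qed
    also have "\<dots> = (B (r k) *v d (r k)) \<bullet> e"
      using arg_cong[OF dual[of "r k"], of "\<lambda>u. - (u \<bullet> e)"] by (simp add: inner_sum_left sum_negf mult.assoc)
    also have "\<dots> \<le> norm (B (r k) *v d (r k)) * norm e"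
      by (rule norm_cauchy_schwarz)
    also have "\<dots> \<le> b * norm (d (r k)) * norm e"
      by (intro mult_right_mono B) simp
    finally show False
      using k(2) by simp
  qed
  then show thesis
    using lim that by blast
qed

text \<open>The Gordan multipliers at \<open>xs\<close> cannot sit on \<open>Lin\<close> alone,
  since \<open>e\<close> strictly decreases those objectives. The weighted sum of objectives
  therefore has zero gradient at \<open>xs\<close> and a positive convexity modulus.\<close>

lemma critical_quadratic_growth:
  fixes F :: "real^'n \<Rightarrow> real^'m"
  assumes crit: "pareto_critical F xs"
    and sc: "\<And>i. rel_strongly_convex (\<nu> i) B (\<lambda>x. F x $ i)"
    and B: "sym_pos_def B" "loewner_le (mat a) B" "0 < a"
    and \<nu>: "\<And>i. 0 \<le> \<nu> i" "\<And>i. i \<notin> Lin \<Longrightarrow> 0 < \<nu> i"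
    and e: "\<And>i. i \<in> Lin \<Longrightarrow> grad (\<lambda>x. F x $ i) xs \<bullet> e < 0"
  obtains l \<kappa> where "0 < \<kappa>" "\<And>i. 0 \<le> l i"
    "\<And>y. \<kappa> * (norm (y - xs))\<^sup>2 \<le> (\<Sum>i\<in>UNIV. l i * (F y $ i - F xs $ i))"
proof (cases rule: Gordan_alternative[of "\<lambda>i. grad (\<lambda>x. F x $ i) xs" 0])
  case (multipliers l)
  have "\<exists>i. i \<notin> Lin \<and> 0 < l i"
  proof (rule ccontr)
    assume "\<not> ?thesis"
    then have z: "l i = 0" if "i \<notin> Lin" for i
      using that multipliers(1)[of i] by (metis less_eq_real_def)
    have nonpos: "l i * (grad (\<lambda>x. F x $ i) xs \<bullet> e) \<le> 0" for i
      using z[of i] e[of i] multipliers(1)[of i] by (cases "i \<in> Lin") (auto simp: mult_le_0_iff)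
    have "(\<Sum>i\<in>UNIV. l i * (grad (\<lambda>x. F x $ i) xs \<bullet> e)) = 0"
      using arg_cong[OF multipliers(3), of "\<lambda>u. u \<bullet> e"] by (simp add: inner_sum_left)
    then have "l i * (grad (\<lambda>x. F x $ i) xs \<bullet> e) = 0" for i
      using sum_nonneg_eq_0_iff[of UNIV "\<lambda>i. - (l i * (grad (\<lambda>x. F x $ i) xs \<bullet> e))"] nonpos
      by (simp add: sum_negf)
    then have "l i = 0" for i
      using z[of i] e[of i] by (metis less_irrefl mult_eq_0_iff)
    then show False
      using multipliers(2) by simp
  qed
  then obtain i0 where i0: "i0 \<notin> Lin" "0 < l i0"
    by blast
  define \<kappa> where "\<kappa> = (\<Sum>i\<in>UNIV. l i * (\<nu> i * a / 2))"
  have nn: "0 \<le> l i * (\<nu> i * a / 2)" for i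
    using multipliers(1)[of i] \<nu>(1)[of i] B(3) by simp
  have "0 < l i0 * (\<nu> i0 * a / 2)"
    using i0 \<nu>(2) B(3) by simp
  then have \<kappa>: "0 < \<kappa>"
    unfolding \<kappa>_def using nn by (intro sum_pos2[of UNIV i0]) auto
  have "\<kappa> * (norm (y - xs))\<^sup>2 \<le> (\<Sum>i\<in>UNIV. l i * (F y $ i - F xs $ i))" for y
  proof -
    have "\<kappa> * (norm (y - xs))\<^sup>2 = (\<Sum>i\<in>UNIV. l i * (\<nu> i * a / 2 * (norm (y - xs))\<^sup>2))"
      unfolding \<kappa>_def sum_distrib_right by (simp add: mult_ac)
    also have "\<dots> \<le> (\<Sum>i\<in>UNIV. l i * (F y $ i - F xs $ i - grad (\<lambda>x. F x $ i) xs \<bullet> (y - xs)))"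
    proof (intro sum_mono mult_left_mono multipliers(1))
      fix i
      show "\<nu> i * a / 2 * (norm (y - xs))\<^sup>2 \<le> F y $ i - F xs $ i - grad (\<lambda>x. F x $ i) xs \<bullet> (y - xs)"
        using rel_strongly_convex_norm[OF sc[of i] B(1,2) \<nu>(1), of xs y] by simp
    qed
    also have "\<dots> = (\<Sum>i\<in>UNIV. l i * (F y $ i - F xs $ i))
        - (\<Sum>i\<in>UNIV. l i *\<^sub>R grad (\<lambda>x. F x $ i) xs) \<bullet> (y - xs)"
      by (simp add: inner_sum_left right_diff_distrib sum_subtractf)
    finally show ?thesis
      unfolding multipliers(3) by simp
  qed
  then show thesis
    using that \<kappa> multipliers(1) by blast
next
  case (direction e)
  then show thesis
    using crit unfolding pareto_critical_def by auto
qed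

lemma pareto_solution_if_quadratic_growth:
  assumes \<kappa>: "0 < \<kappa>" and l: "\<And>i. 0 \<le> l i"
    and growth: "\<And>y. \<kappa> * (norm (y - xs))\<^sup>2 \<le> (\<Sum>i\<in>UNIV. l i * (F y $ i - F xs $ i))"
  shows "pareto_solution F xs"
  unfolding pareto_solution_def
proof (rule notI, elim exE conjE)
  fix y assume y: "\<forall>i. F y $ i \<le> F xs $ i" "F y \<noteq> F xs"
  have "\<kappa> * (norm (y - xs))\<^sup>2 \<le> 0"
    by (rule order_trans[OF growth sum_nonpos]) (simp add: mult_nonneg_nonpos l y(1))
  then have "y = xs"
    using \<kappa> by (simp add: mult_le_0_iff)
  then show False
    using y(2) by simp
qed

text \<open>This upgrades convergence of the objective values to convergence of the whole sequence
  of iterates.\<close>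

lemma tendsto_if_quadratic_growth:
  assumes \<kappa>: "0 < \<kappa>"
    and growth: "\<And>y. \<kappa> * (norm (y - xs))\<^sup>2 \<le> (\<Sum>i\<in>UNIV. l i * (F y $ i - F xs $ i))"
    and lim: "\<And>i. (\<lambda>k. F (x k) $ i) \<longlonglongrightarrow> F xs $ i"
  shows "x \<longlonglongrightarrow> xs"
proof -
  have "(\<lambda>k. (\<Sum>i\<in>UNIV. l i * (F (x k) $ i - F xs $ i)) / \<kappa>)
      \<longlonglongrightarrow> (\<Sum>i\<in>UNIV. l i * (F xs $ i - F xs $ i)) / \<kappa>"
    using \<kappa> by (intro tendsto_intros lim) auto
  then have gap: "(\<lambda>k. (\<Sum>i\<in>UNIV. l i * (F (x k) $ i - F xs $ i)) / \<kappa>) \<longlonglongrightarrow> 0"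
    by simp
  have "(norm (x k - xs))\<^sup>2 \<le> (\<Sum>i\<in>UNIV. l i * (F (x k) $ i - F xs $ i)) / \<kappa>" for k
    using growth[of "x k"] \<kappa> by (simp add: pos_le_divide_eq mult.commute)
  then show ?thesis
    by (rule tendsto_if_norm_sq_diff_le[OF _ gap])
qed

section \<open>Step sizes, level sets and the constant \<epsilon>\<close>

lemma bb_step_range:
  assumes "\<alpha>min \<le> \<alpha>max"
  shows "\<alpha>min \<le> bb_step \<alpha>min \<alpha>max B s y" "bb_step \<alpha>min \<alpha>max B s y \<le> \<alpha>max"
  using assms unfolding bb_step_def by auto

lemma dir_objective_eq:
  assumes "sym_pos_def B"
  shows "dir_objective F \<alpha> B x e
    = (MAX i. (grad (\<lambda>x. F x $ i) x /\<^sub>R \<alpha> i) \<bullet> e + 1/2 * (e \<bullet> (B *v e)))"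
proof -
  have "grad (\<lambda>x. F x $ i) x \<bullet> e / \<alpha> i = (grad (\<lambda>x. F x $ i) x /\<^sub>R \<alpha> i) \<bullet> e" for i
    by (simp add: divide_inverse mult.commute)
  then show ?thesis
    unfolding dir_objective_def norm_B_sq[OF assms] by simp
qed

text \<open>One strongly convex component confines the level set to a ball, by Cauchy-Schwarz.
  Boundedness is what lets \<open>diameter\<close> control distances in the gradient
  estimate.\<close>

lemma bounded_level_set:
  fixes F :: "real^'n \<Rightarrow> real^'m"
  assumes "rel_strongly_convex \<mu> B (\<lambda>x. F x $ i)" "sym_pos_def B" "loewner_le (mat a) B" "0 < \<mu>" "0 < a"
  shows "bounded (level_set F x)"
proof (rule bounded_subset[OF bounded_cball])
  define g where "g = grad (\<lambda>x. F x $ i) x"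
  define c where "c = \<mu> * a"
  have c: "0 < c"
    using assms by (simp add: c_def)
  show "level_set F x \<subseteq> cball x (2 * norm g / c)"
  proof
    fix y assume "y \<in> level_set F x"
    then have "F y $ i \<le> F x $ i"
      by (simp add: level_set_def)
    then have "c / 2 * (norm (y - x))\<^sup>2 \<le> - (g \<bullet> (y - x))"
      using rel_strongly_convex_norm[OF assms(1,2,3), of x y] assms(4) by (simp add: g_def c_def)
    also have "\<dots> \<le> norm g * norm (y - x)"
      using Cauchy_Schwarz_ineq2[of g "y - x"] by linarith
    finally have le: "norm (y - x) * (c * norm (y - x)) \<le> norm (y - x) * (2 * norm g)"
      by (simp add: power2_eq_square mult_ac)
    have "c * norm (y - x) \<le> 2 * norm g"
    proof (cases "y = x")
      case False
      then have "0 < norm (y - x)"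
        by simp
      then show ?thesis
        using le by (rule mult_left_le_imp_le[rotated])
    qed simp
    then show "y \<in> cball x (2 * norm g / c)"
      using c by (simp add: dist_norm norm_minus_commute pos_le_divide_eq mult.commute)
  qed
qed

lemma lin_grad_eps_attained:
  fixes F :: "real^'n \<Rightarrow> real^'m"
  assumes "Lin \<noteq> {}"
  obtains v where "v \<in> convex hull ((\<lambda>i. grad (\<lambda>x. F x $ i) x) ` Lin)" "lin_grad_eps F Lin x = norm v"
    "\<And>u. u \<in> convex hull ((\<lambda>i. grad (\<lambda>x. F x $ i) x) ` Lin) \<Longrightarrow> norm v \<le> norm u"
proof -
  let ?C = "convex hull ((\<lambda>i. grad (\<lambda>x. F x $ i) x) ` Lin)"
  have "compact ?C"
    by (intro finite_imp_compact_convex_hull) simp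
  moreover have "?C \<noteq> {}"
    using assms by simp
  ultimately obtain v where v: "v \<in> ?C" "\<And>u. u \<in> ?C \<Longrightarrow> norm v \<le> norm u"
    using continuous_attains_inf[of ?C norm] by (metis continuous_on_norm_id)
  then have "lin_grad_eps F Lin x = norm v"
    unfolding lin_grad_eps_def by (intro cInf_eq_minimum) auto
  then show thesis
    using that v by blast
qed

text \<open>A common descent direction at a noncritical point puts the hull in an open half-space
  missing the origin, and the minimal norm is attained.\<close>

lemma lin_grad_eps_pos:
  assumes "Lin \<noteq> {}" and "\<not> pareto_critical F x"
  shows "0 < lin_grad_eps F Lin x"
proof -
  obtain v where v: "v \<in> convex hull ((\<lambda>i. grad (\<lambda>x. F x $ i) x) ` Lin)" "lin_grad_eps F Lin x = norm v"
    using lin_grad_eps_attained[OF assms(1)] by metis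
  obtain e where e: "\<And>i. grad (\<lambda>x. F x $ i) x \<bullet> e < 0"
    using assms(2) unfolding pareto_critical_def by blast
  have "convex hull ((\<lambda>i. grad (\<lambda>x. F x $ i) x) ` Lin) \<subseteq> {u. e \<bullet> u < 0}"
    using e by (intro hull_minimal convex_halfspace_lt) (auto simp: inner_commute)
  then have "v \<noteq> 0"
    using v(1) by auto
  then show ?thesis
    using v(2) by simp
qed

lemma sum_UNIV_split: "(\<Sum>i\<in>UNIV. f i) = (\<Sum>i\<in>S. f i) + (\<Sum>i\<in>-S. f (i::'m::finite))"
  using sum.Int_Diff[of UNIV f S] by (simp add: Compl_eq_Diff_UNIV)

section \<open>Convergence and linear rate along a run of the algorithm\<close>

theorem theorem5p4:
  fixes F :: "real^'n \<Rightarrow> real^'m"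
    and Lin :: "'m set"
    and \<alpha>min \<alpha>max \<sigma> \<gamma> a b :: real
    and B :: "nat \<Rightarrow> real^'n^'n"
    and xm :: "real^'n"
    and x :: "nat \<Rightarrow> real^'n"
    and Lk \<mu> :: "'m \<Rightarrow> nat \<Rightarrow> real"
    and L \<delta> :: "'m \<Rightarrow> real"
  assumes "continuously_diff F"
    and "Lin \<noteq> {}" and "- Lin \<noteq> {}"
    and "0 < \<alpha>min" and "\<alpha>min \<le> \<alpha>max"
    and "0 < \<sigma>" and "\<sigma> < 1" and "0 < \<gamma>" and "\<gamma> < 1"
    and "bbdmo_vm_run F \<alpha>min \<alpha>max \<sigma> \<gamma> B xm x"
    and "\<And>k. \<not> pareto_critical F (x k)"
    and "0 < a" and "0 < b"
    and "\<And>k. loewner_le (mat a) (B k) \<and> loewner_le (B k) (mat b)"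
    and "\<And>i. i \<in> Lin \<Longrightarrow> linear_objective (\<lambda>x. F x $ i)"
    and "\<And>i k. i \<notin> Lin \<Longrightarrow> rel_smooth (Lk i k) (B k) (\<lambda>x. F x $ i)"
    and "\<And>i k. i \<notin> Lin \<Longrightarrow> rel_strongly_convex (\<mu> i k) (B k) (\<lambda>x. F x $ i)"
    and "\<And>i k. i \<notin> Lin \<Longrightarrow> Lk i k \<le> L i"
    and "\<And>i k. i \<notin> Lin \<Longrightarrow> \<delta> i \<le> \<mu> i k"
    and "\<And>i. i \<notin> Lin \<Longrightarrow> 0 < \<delta> i"
    and "\<And>i k. i \<notin> Lin \<Longrightarrow> \<alpha>min \<le> Lk i k \<and> \<mu> i k \<le> \<alpha>max"
  shows "(\<exists>xs. pareto_solution F xs \<and> x \<longlonglongrightarrow> xs)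
    \<and> 0 < lin_grad_eps F Lin (x 0)
    \<and> (\<forall>k. merit_u0 F (delta_alpha Lin \<alpha>min \<delta>) (x (Suc k))
          \<le> (1 - 2 * \<gamma> * \<sigma> * (1 - \<sigma>) * (1 - rate_c F Lin a b L \<delta> (x 0) * \<alpha>min)
                 * (MIN i\<in>- Lin. \<mu> i k * (\<delta> i)\<^sup>2 / (Lk i k) ^ 3))
            * merit_u0 F (delta_alpha Lin \<alpha>min \<delta>) (x k))"
proof -
  note pos = \<open>0 < \<alpha>min\<close> \<open>0 < \<sigma>\<close> \<open>\<sigma> < 1\<close> \<open>0 < \<gamma>\<close> \<open>\<gamma> < 1\<close> \<open>0 < a\<close> \<open>0 < b\<close>
  note lin = assms(15) and Lk_le = assms(18) and \<delta>_le = assms(19) and \<delta>_pos = assms(20)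
  have lo: "loewner_le (mat a) (B k)" and up: "loewner_le (B k) (mat b)" for k
    using assms(14) by auto
  define g where "g = (\<lambda>k i. grad (\<lambda>x. F x $ i) (x k))"
  define l0 where "l0 = (\<lambda>k i. if i \<in> Lin then 0 else Lk i k)"
  define \<nu> where "\<nu> = (\<lambda>k i. if i \<in> Lin then 0 else \<mu> i k)"
  define S where "S = - Lin"
  have S: "S \<noteq> {}" "\<And>i. i \<in> S \<longleftrightarrow> i \<notin> Lin"
    using \<open>- Lin \<noteq> {}\<close> by (auto simp: S_def)
  have smooth: "rel_smooth (l0 k i) (B k) (\<lambda>x. F x $ i)" for k i
    using linear_objective_rel_smooth(1)[OF lin] assms(16) by (simp add: l0_def)
  have sc: "rel_strongly_convex (\<nu> k i) (B k) (\<lambda>x. F x $ i)" for k i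
    using linear_objective_rel_smooth(2)[OF lin] assms(17) by (simp add: \<nu>_def)
  have \<mu>_pos: "0 < \<mu> i k" if "i \<notin> Lin" for i k
    using \<delta>_pos[OF that] \<delta>_le[OF that, of k] by linarith
  have Lk_pos: "0 < Lk i k" if "i \<notin> Lin" for i k
    using assms(21)[OF that, of k] pos(1) by linarith
  have \<nu>_nonneg: "0 \<le> \<nu> k i" for k i
    using \<mu>_pos by (simp add: \<nu>_def less_imp_le)

  obtain \<alpha> d t where spd: "\<And>k. sym_pos_def (B k)" and xm: "xm \<noteq> x 0"
    and \<alpha>: "\<And>k i. \<alpha> k i = bb_step \<alpha>min \<alpha>max (B k) (x k - prev_iterate xm x k)
                (grad (\<lambda>x. F x $ i) (x k) - grad (\<lambda>x. F x $ i) (prev_iterate xm x k))"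
    and argmin: "\<And>k. is_arg_min (dir_objective F (\<alpha> k) (B k) (x k)) (\<lambda>_. True) (d k)"
    and d: "\<And>k. d k \<noteq> 0"
    and t: "\<And>k. t k \<in> armijo_steps F \<sigma> \<gamma> (x k) (d k)"
      "\<And>k s. s \<in> armijo_steps F \<sigma> \<gamma> (x k) (d k) \<Longrightarrow> s \<le> t k"
    and step: "\<And>k. x (Suc k) = x k + t k *\<^sub>R d k"
    using assms(10) unfolding bbdmo_vm_run_def by metis
  define q where "q = (\<lambda>k. (norm_B (B k) (d k))\<^sup>2)"
  have q: "q k = d k \<bullet> (B k *v d k)" "0 \<le> q k" for k
    by (simp_all add: q_def norm_B_sq[OF spd] sym_pos_def_nonneg[OF spd])
  have q_ge: "a * (norm (d k))\<^sup>2 \<le> q k" for k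
    using loewner_le_mat_lower[OF lo] unfolding q .
  \<comment> \<open>Positive steps along nonzero directions keep consecutive iterates distinct, as
    \<open>bb_step_bounds\<close> requires; for \<open>k = 0\<close> this is the choice of
    \<open>xm\<close>.\<close>
  have "0 < t k" for k
    using t(1)[of k] pos unfolding armijo_steps_def by auto
  then have prev: "x k \<noteq> prev_iterate xm x k" for k
    using xm d step unfolding prev_iterate_def by (cases k) (simp_all, metis less_irrefl)

  have \<alpha>_range: "\<alpha>min \<le> \<alpha> k i" "\<alpha> k i \<le> \<alpha>max" for k i
    unfolding \<alpha> by (rule bb_step_range[OF assms(5)])+
  have \<alpha>_pos: "0 < \<alpha> k i" for k i
    using \<alpha>_range(1)[of k i] pos by linarith
  \<comment> \<open>A constant gradient makes the difference \<open>y\<close> zero, which selects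
    the last case of \<open>bb_step\<close>.\<close>
  have \<alpha>_lin: "\<alpha> k i = \<alpha>min" if "i \<in> Lin" for k i
    unfolding \<alpha> linear_objective_grad[OF lin[OF that], of "x k" "prev_iterate xm x k"]
    by (simp add: bb_step_def)
  have \<alpha>_nonlin: "\<mu> i k \<le> \<alpha> k i" "\<alpha> k i \<le> Lk i k" if "i \<notin> Lin" for k i
    using bb_step_bounds[OF assms(16)[OF that] assms(17)[OF that] spd prev \<mu>_pos[OF that]] assms(21)[OF that]
    unfolding \<alpha> by blast+

  have min: "(MAX i. (g k i /\<^sub>R \<alpha> k i) \<bullet> d k + 1/2 * (d k \<bullet> (B k *v d k)))
      \<le> (MAX i. (g k i /\<^sub>R \<alpha> k i) \<bullet> e + 1/2 * (e \<bullet> (B k *v e)))" for k e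
    using argmin[of k] unfolding is_arg_min_def dir_objective_eq[OF spd] g_def by (meson not_less)
  have sym: "transpose (B k) = B k" for k
    using spd by (simp add: sym_pos_def_def)
  have descent: "g k i \<bullet> d k \<le> - (\<alpha> k i * q k)" for k i
  proof -
    have "(g k i /\<^sub>R \<alpha> k i) \<bullet> d k \<le> - q k"
      unfolding q by (rule quadratic_max_minimizer_descent[OF sym sym_pos_def_nonneg[OF spd] min])
    then have "\<alpha> k i * ((g k i /\<^sub>R \<alpha> k i) \<bullet> d k) \<le> \<alpha> k i * - q k"
      using \<alpha>_pos[of k i] by (intro mult_left_mono) auto
    then show ?thesis
      using \<alpha>_pos[of k i] by (simp add: mult.assoc[symmetric])
  qed
  have "\<forall>k. \<exists>l. (\<forall>i. 0 \<le> l i) \<and> (\<Sum>i\<in>UNIV. l i) = 1 \<and>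
      (\<Sum>i\<in>UNIV. l i *\<^sub>R (g k i /\<^sub>R \<alpha> k i)) = - (B k *v d k)"
    by (intro allI quadratic_max_minimizer_multipliers[OF sym sym_pos_def_nonneg[OF spd] min])
  then obtain l where "\<forall>k. (\<forall>i. 0 \<le> l k i) \<and> (\<Sum>i\<in>UNIV. l k i) = 1 \<and>
      (\<Sum>i\<in>UNIV. l k i *\<^sub>R (g k i /\<^sub>R \<alpha> k i)) = - (B k *v d k)"
    by (rule choice[THEN exE])
  then have l: "0 \<le> l k i" "(\<Sum>i\<in>UNIV. l k i) = 1"
    and dual: "(\<Sum>i\<in>UNIV. l k i *\<^sub>R (g k i /\<^sub>R \<alpha> k i)) = - (B k *v d k)" for k i
    by simp_all

  \<comment> \<open>The worst ratio \<open>\<mu> / L\<close> at iteration \<open>k\<close>. It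
    satisfies \<open>\<rho> * l0 \<le> \<alpha>\<close> for every objective, as the line search
    estimate demands.\<close>
  define \<rho> where "\<rho> = (\<lambda>k. MIN i\<in>S. \<mu> i k / Lk i k)"
  have \<rho>_attained: "\<exists>i\<in>S. \<rho> k = \<mu> i k / Lk i k" for k
  proof -
    have "\<rho> k \<in> (\<lambda>i. \<mu> i k / Lk i k) ` S"
      unfolding \<rho>_def using S by (intro Min_in) auto
    then show ?thesis
      by blast
  qed
  have \<rho>_le: "\<rho> k \<le> \<mu> i k / Lk i k" if "i \<in> S" for i k
    unfolding \<rho>_def using that by (intro Min_le) auto
  have \<rho>: "0 < \<rho> k" "\<rho> k \<le> 1" for k
  proof -
    obtain i where i: "i \<notin> Lin" "\<rho> k = \<mu> i k / Lk i k"
      using \<rho>_attained S(2) by blast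
    show "0 < \<rho> k" "\<rho> k \<le> 1"
      using \<mu>_pos[OF i(1), of k] Lk_pos[OF i(1), of k] \<alpha>_nonlin[OF i(1), of k] unfolding i(2) by simp_all
  qed
  define K where "K = 2 * \<gamma> * \<sigma> * (1 - \<sigma>)"
  have K: "0 < K"
    using pos by (simp add: K_def)
  have decrease: "F (x (Suc k)) $ i \<le> F (x k) $ i - K * \<rho> k * (\<alpha> k i * q k)" for k i
  proof -
    have "F (x k + t k *\<^sub>R d k) $ i - F (x k) $ i \<le> 2 * \<gamma> * \<sigma> * (1 - \<sigma>) * \<rho> k * (grad (\<lambda>x. F x $ i) (x k) \<bullet> d k)"
    proof (rule armijo_decrease[where l="l0 k" and \<alpha>="\<alpha> k"])
      show "0 \<le> l0 k i" for i
        using Lk_pos by (simp add: l0_def less_imp_le)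
      show "\<rho> k * l0 k i \<le> \<alpha> k i" for i
      proof (cases "i \<in> Lin")
        case True
        then show ?thesis
          using \<alpha>_pos[of k i] by (simp add: l0_def)
      next
        case False
        then have "\<rho> k * Lk i k \<le> \<mu> i k"
          using \<rho>_le[of i k] Lk_pos[of i k] by (simp add: S(2) pos_le_divide_eq)
        then show ?thesis
          using False \<alpha>_nonlin(1)[of i k] by (simp add: l0_def)
      qed
      show "grad (\<lambda>x. F x $ i) (x k) \<bullet> d k \<le> - (\<alpha> k i * (norm_B (B k) (d k))\<^sup>2)" for i
        using descent[of k i] by (simp add: g_def q_def)
    qed (use pos t spd d smooth \<rho> in simp_all)
    also have "\<dots> = K * \<rho> k * (g k i \<bullet> d k)"
      by (simp add: K_def g_def)
    also have "\<dots> \<le> K * \<rho> k * - (\<alpha> k i * q k)"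
      using descent K \<rho>(1)[of k] by (intro mult_left_mono) auto
    finally show ?thesis
      by (simp add: step)
  qed
  have "decseq (\<lambda>k. F (x k) $ i)" for i
  proof (rule decseq_SucI)
    fix k
    have "0 \<le> K * \<rho> k * (\<alpha> k i * q k)"
      using K \<rho>(1)[of k] \<alpha>_pos[of k i] q(2)[of k] by simp
    then show "F (x (Suc k)) $ i \<le> F (x k) $ i"
      using decrease[of k i] by linarith
  qed
  then have level: "x k \<in> level_set F (x 0)" for k
    by (simp add: level_set_def decseq_def)
  obtain i0 where i0: "i0 \<notin> Lin"
    using S by blast
  have bounded_level: "bounded (level_set F (x 0))"
    using bounded_level_set[OF assms(17)[OF i0, of 0] spd lo \<mu>_pos[OF i0]] pos by blast

  have "\<exists>xs. pareto_solution F xs \<and> x \<longlonglongrightarrow> xs"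
  proof -
    \<comment> \<open>A lower bound for all \<open>\<rho> k\<close>: the uniform constants
      \<open>L i\<close> and \<open>\<delta> i\<close> keep the decrease from degenerating.\<close>
    define \<rho>0 where "\<rho>0 = (MIN i\<in>S. \<delta> i / L i)"
    have L_pos: "0 < L i" if "i \<notin> Lin" for i
      using Lk_pos[OF that, of 0] Lk_le[OF that, of 0] by linarith
    have "\<rho>0 \<in> (\<lambda>i. \<delta> i / L i) ` S"
      unfolding \<rho>0_def using S by (intro Min_in) auto
    then have \<rho>0: "0 < \<rho>0"
      using \<delta>_pos L_pos S(2) by auto
    have \<rho>0_le: "\<rho>0 \<le> \<rho> k" for k
    proof -
      obtain i where i: "i \<in> S" "\<rho> k = \<mu> i k / Lk i k"
        using \<rho>_attained by blast
      then have i': "i \<notin> Lin"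
        using S(2) by blast
      have "\<rho>0 \<le> \<delta> i / L i"
        unfolding \<rho>0_def using i(1) by (intro Min_le) auto
      also have "\<dots> \<le> \<mu> i k / Lk i k"
        using i' \<delta>_le \<mu>_pos Lk_pos Lk_le by (intro frac_le) (auto intro: less_imp_le)
      finally show ?thesis
        unfolding i(2) .
    qed
    obtain xs where crit: "pareto_critical F xs" and lim: "\<And>i. (\<lambda>k. F (x k) $ i) \<longlonglongrightarrow> F xs $ i"
    \<comment> \<open>The constant \<open>c\<close> combines \<open>\<rho>0 \<le> \<rho> k\<close>,
      \<open>\<alpha>min \<le> \<alpha> k i\<close> and
      \<open>a * (norm (d k))^2 \<le> q k\<close>.\<close>
    proof (rule critical_limit_point[where F=F and x=x and d=d and l=l and \<alpha>=\<alpha> and B=B and b=b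
          and A=\<alpha>max and c="K * \<rho>0 * (\<alpha>min * a)"])
      show "bounded (range x)"
        using bounded_level level by (rule bounded_subset[OF _ image_subsetI])
      fix k i
      have "K * \<rho>0 * (\<alpha>min * a) * (norm (d k))\<^sup>2 = K * \<rho>0 * (\<alpha>min * (a * (norm (d k))\<^sup>2))"
        by simp
      also have "\<dots> \<le> K * \<rho> k * (\<alpha> k i * q k)"
        using K \<rho>0 \<rho>0_le \<alpha>_range q_ge pos \<alpha>_pos[of k i] \<rho>(1)[of k]
        by (intro mult_mono) (auto intro: less_imp_le)
      finally show "F (x (Suc k)) $ i \<le> F (x k) $ i - K * \<rho>0 * (\<alpha>min * a) * (norm (d k))\<^sup>2"
        using decrease[of k i] by linarith
      show "(\<Sum>i\<in>UNIV. l k i *\<^sub>R (grad (\<lambda>x. F x $ i) (x k) /\<^sub>R \<alpha> k i)) = - (B k *v d k)"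
        using dual by (simp add: g_def)
      show "norm (B k *v v) \<le> b * norm v" for v
        using norm_matrix_le[OF spd up] pos by blast
    qed (use assms(1) l \<alpha>_pos \<alpha>_range K \<rho>0 pos in auto)
    \<comment> \<open>Linear gradients are constant, so a descent direction at \<open>x 0\<close>
      still decreases the linear objectives at \<open>xs\<close>. Growth around \<open>xs\<close>
      then needs only the matrix and moduli of iteration 0.\<close>
    obtain e where e: "\<And>i. grad (\<lambda>x. F x $ i) (x 0) \<bullet> e < 0"
      using assms(11)[of 0] unfolding pareto_critical_def by blast
    have e': "grad (\<lambda>x. F x $ i) xs \<bullet> e < 0" if "i \<in> Lin" for i
      using e linear_objective_grad[OF lin[OF that]] by metis
    have "0 < \<nu> 0 i" if "i \<notin> Lin" for i
      using that \<mu>_pos by (simp add: \<nu>_def)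
    then obtain m \<kappa> where growth: "0 < \<kappa>" "\<And>i. 0 \<le> m i"
      "\<And>y. \<kappa> * (norm (y - xs))\<^sup>2 \<le> (\<Sum>i\<in>UNIV. m i * (F y $ i - F xs $ i))"
      by (rule critical_quadratic_growth[OF crit sc[of 0] spd lo \<open>0 < a\<close> \<nu>_nonneg _ e']) blast+
    have "pareto_solution F xs"
      by (rule pareto_solution_if_quadratic_growth[OF growth])
    moreover have "x \<longlonglongrightarrow> xs"
      by (rule tendsto_if_quadratic_growth[OF growth(1,3) lim])
    ultimately show ?thesis
      by blast
  qed

  moreover have \<epsilon>: "0 < lin_grad_eps F Lin (x 0)"
    using lin_grad_eps_pos[OF \<open>Lin \<noteq> {}\<close> assms(11)] .

  moreover have "merit_u0 F (delta_alpha Lin \<alpha>min \<delta>) (x (Suc k))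
      \<le> (1 - 2 * \<gamma> * \<sigma> * (1 - \<sigma>) * (1 - rate_c F Lin a b L \<delta> (x 0) * \<alpha>min)
             * (MIN i\<in>- Lin. \<mu> i k * (\<delta> i)\<^sup>2 / (Lk i k) ^ 3))
        * merit_u0 F (delta_alpha Lin \<alpha>min \<delta>) (x k)" for k
  proof -
    define w where "w = delta_alpha Lin \<alpha>min \<delta>"
    define u where "u = merit_u0 F w"
    define c where "c = rate_c F Lin a b L \<delta> (x 0)"
    define T where "T = (MIN i\<in>S. \<mu> i k * (\<delta> i)\<^sup>2 / (Lk i k) ^ 3)"
    define P where "P = (\<Sum>i\<in>UNIV. l k i * (w i / \<alpha> k i))"
    define Q where "Q = (\<Sum>i\<in>UNIV. l k i * (\<nu> k i / \<alpha> k i))"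
    define \<Lambda> where "\<Lambda> = (\<Sum>i\<in>S. l k i)"
    have w: "0 < w i" "w i \<le> \<alpha> k i" for i
      using pos \<delta>_pos[of i] \<alpha>_lin[of i k] \<alpha>_nonlin[of i k] \<delta>_le[of i k]
      by (auto simp: w_def delta_alpha_def intro: order_trans)

    have "1 - c * \<alpha>min \<le> \<Lambda>"
    proof -
      define \<epsilon> where "\<epsilon> = lin_grad_eps F Lin (x 0)"
      define G where "G = (\<lambda>i. norm (grad (\<lambda>x. F x $ i) (x 0)) + b * L i * diameter (level_set F (x 0)))"
      \<comment> \<open>\<open>rate_c\<close> carries \<open>\<epsilon>\<close> in its denominator,
        while \<open>linear_weight_le\<close> expects a gradient bound without it; hence the bound
        \<open>\<epsilon> * M\<close>.\<close>
      define M where "M = (MAX i\<in>S. G i / (\<epsilon> * \<delta> i))"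
      have grads: "norm (g k i) \<le> (\<epsilon> * M) * \<alpha> k i" if i: "i \<notin> Lin" for i
      proof -
        have "norm (grad (\<lambda>x. F x $ i) (x k) - grad (\<lambda>x. F x $ i) (x 0)) \<le> b * Lk i k * norm (x k - x 0)"
          using rel_smooth_convex_grad_Lipschitz[OF assms(16)[OF i] assms(17)[OF i] less_imp_le[OF \<mu>_pos[OF i]]
              Lk_pos[OF i] up spd] pos by blast
        also have "\<dots> \<le> b * L i * diameter (level_set F (x 0))"
          using diameter_bounded_bound[OF bounded_level level level, of k 0] pos Lk_le[OF i, of k] Lk_pos[OF i, of k]
          by (intro mult_mono) (auto simp: dist_norm)
        finally have gG: "norm (g k i) \<le> G i"
          using norm_triangle_sub[of "grad (\<lambda>x. F x $ i) (x k)" "grad (\<lambda>x. F x $ i) (x 0)"]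
          unfolding g_def G_def by linarith
        have "0 < \<epsilon> * \<delta> i"
          using \<epsilon> \<delta>_pos[OF i] by (simp add: \<epsilon>_def)
        moreover have GM: "G i / (\<epsilon> * \<delta> i) \<le> M"
          unfolding M_def using i S(2) by (intro Max_ge) auto
        ultimately have "G i \<le> M * (\<epsilon> * \<delta> i)"
          by (simp add: pos_divide_le_eq)
        moreover have "0 \<le> G i / (\<epsilon> * \<delta> i)"
          using gG norm_ge_zero[of "g k i"] \<open>0 < \<epsilon> * \<delta> i\<close> by (intro divide_nonneg_pos) linarith+
        then have "M * \<epsilon> * \<delta> i \<le> M * \<epsilon> * \<alpha> k i"
          using GM \<epsilon> \<alpha>_nonlin(1)[OF i, of k] \<delta>_le[OF i, of k] by (intro mult_left_mono) (auto simp: \<epsilon>_def)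
        ultimately show ?thesis
          using gG by (simp add: mult_ac)
      qed
      have hull: "\<epsilon> \<le> norm v" if v: "v \<in> convex hull (g k ` Lin)" for v
      proof -
        have "g k ` Lin = (\<lambda>i. grad (\<lambda>x. F x $ i) (x 0)) ` Lin"
          using linear_objective_grad[OF lin] by (intro image_cong) (auto simp: g_def)
        then show ?thesis
          using v lin_grad_eps_attained[OF \<open>Lin \<noteq> {}\<close>, of F "x 0"] unfolding \<epsilon>_def by metis
      qed
      have "(\<Sum>i\<in>Lin. l k i) * \<epsilon> \<le> \<alpha>min * ((1 + b / a) * (\<epsilon> * M))"
      proof (rule linear_weight_le[where g="g k" and \<alpha>="\<alpha> k" and B="B k" and d="d k"])
        show "a * (norm (d k))\<^sup>2 \<le> d k \<bullet> (B k *v d k)"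
          using q_ge[of k] by (simp add: q)
        show "norm (B k *v d k) \<le> b * norm (d k)"
          using norm_matrix_le[OF spd up] pos by blast
        show "g k i \<bullet> d k \<le> - (\<alpha> k i * (d k \<bullet> (B k *v d k)))" for i
          using descent[of k i] by (simp add: q)
      qed (use pos l dual \<alpha>_pos \<alpha>_lin grads \<open>- Lin \<noteq> {}\<close> hull in auto)
      also have "\<dots> = (c * \<alpha>min) * \<epsilon>"
        by (simp add: c_def rate_c_def M_def G_def \<epsilon>_def S_def)
      finally have "(\<Sum>i\<in>Lin. l k i) \<le> c * \<alpha>min"
        using \<epsilon> by (simp add: \<epsilon>_def)
      then show ?thesis
        using l(2)[of k] sum_UNIV_split[of "l k" S] by (simp add: \<Lambda>_def S_def)
    qed
    \<comment> \<open>Positivity of \<open>T\<close> allows multiplying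
      \<open>1 - c * \<alpha>min \<le> \<Lambda>\<close> by it, whatever the sign of the left
      side.\<close>
    moreover have "0 < T"
    proof -
      have "T \<in> (\<lambda>i. \<mu> i k * (\<delta> i)\<^sup>2 / (Lk i k) ^ 3) ` S"
        unfolding T_def using S by (intro Min_in) auto
      then obtain i where "i \<in> S" "T = \<mu> i k * (\<delta> i)\<^sup>2 / (Lk i k) ^ 3"
        by blast
      then show ?thesis
        using \<mu>_pos[of i k] \<delta>_pos[of i] Lk_pos[of i k] S(2) by simp
    qed
    moreover have "\<Lambda> * T \<le> \<rho> k * (P * Q)"
    proof -
      have "(\<Sum>i\<in>S. l k i * (\<nu> k i / \<alpha> k i)) = (\<Sum>i\<in>S. l k i * (\<mu> i k / \<alpha> k i))"
        by (intro sum.cong) (auto simp: \<nu>_def S(2))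
      moreover have "(\<Sum>i\<in>-S. l k i * (\<nu> k i / \<alpha> k i)) = 0"
        by (intro sum.neutral) (auto simp: \<nu>_def S(2))
      ultimately have "Q = (\<Sum>i\<in>S. l k i * (\<mu> i k / \<alpha> k i))"
        unfolding Q_def sum_UNIV_split[of _ S] by simp
      moreover have "\<Lambda> * T \<le> \<rho> k * (P * (\<Sum>i\<in>S. l k i * (\<mu> i k / \<alpha> k i)))"
        unfolding \<Lambda>_def T_def \<rho>_def P_def
      proof (rule rate_inequality[where L="\<lambda>i. Lk i k" and \<mu>="\<lambda>i. \<mu> i k"])
        show "0 < \<delta> i \<and> \<delta> i \<le> \<mu> i k \<and> \<mu> i k \<le> \<alpha> k i \<and> \<alpha> k i \<le> Lk i k" if "i \<in> S" for i
          using that \<delta>_pos \<delta>_le \<alpha>_nonlin S(2) by blast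
        show "w i = \<delta> i" if "i \<in> S" for i
          using that S(2) by (simp add: w_def delta_alpha_def)
        show "w i = \<alpha> k i \<and> 0 < \<alpha> k i" if "i \<notin> S" for i
          using that S(2) \<alpha>_lin[of i k] pos by (simp add: w_def delta_alpha_def)
      qed (use l S in auto)
      ultimately show ?thesis
        by simp
    qed
    ultimately have rate: "(1 - c * \<alpha>min) * T \<le> \<rho> k * (P * Q)"
      using mult_right_mono[of "1 - c * \<alpha>min" \<Lambda> T] by linarith

    have PQ: "0 \<le> P * Q"
      unfolding P_def Q_def
      by (intro mult_nonneg_nonneg sum_nonneg divide_nonneg_nonneg l)
        (use w(1) \<alpha>_pos \<nu>_nonneg in \<open>auto intro: less_imp_le\<close>)
    have bdd: "bdd_above (range (\<lambda>y. MIN i. (F (x k) $ i - F y $ i) / w i))"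
      by (rule merit_bdd_above[OF assms(17)[OF i0] spd lo \<mu>_pos[OF i0] \<open>0 < a\<close> w(1)])
    have u0: "0 \<le> u (x k)"
      unfolding u_def by (rule merit_nonneg[OF bdd])
    have "u (x k) * (2 * (P * Q)) \<le> q k"
      unfolding u_def P_def Q_def q_def
    proof (rule merit_le_direction)
      fix y
      show "(MIN i. (F (x k) $ i - F y $ i) / w i)
          * (2 * ((\<Sum>i\<in>UNIV. l k i * (w i / \<alpha> k i)) * (\<Sum>i\<in>UNIV. l k i * (\<nu> k i / \<alpha> k i))))
          \<le> (norm_B (B k) (d k))\<^sup>2"
        by (rule merit_gap_le_direction[OF spd l(1) w(1) \<alpha>_pos \<nu>_nonneg sc dual[unfolded g_def]])
    qed (use PQ in \<open>simp_all add: P_def Q_def\<close>)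
    \<comment> \<open>A factor two in the merit estimate is given up here, to match the constant of
      the stated rate.\<close>
    moreover have "u (x k) * (P * Q) \<le> u (x k) * (2 * (P * Q))"
      using u0 PQ by (intro mult_left_mono) auto
    ultimately have "u (x k) * (P * Q) \<le> q k"
      by linarith
    then have "K * \<rho> k * (u (x k) * (P * Q)) \<le> K * \<rho> k * q k"
      using K \<rho>(1)[of k] by (intro mult_left_mono) auto
    moreover have "K * u (x k) * ((1 - c * \<alpha>min) * T) \<le> K * u (x k) * (\<rho> k * (P * Q))"
      using rate K u0 by (intro mult_left_mono) auto
    ultimately have "K * (1 - c * \<alpha>min) * T * u (x k) \<le> K * \<rho> k * q k"
      by (simp add: mult_ac)
    \<comment> \<open>Every \<open>F x $ i\<close> drops by at least
      \<open>\<alpha> k i * (K * \<rho> k * q k)\<close>, and \<open>w i \<le> \<alpha> k i\<close>,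
      so the merit function drops by the common amount.\<close>
    moreover have "u (x (Suc k)) \<le> u (x k) - K * \<rho> k * q k"
      unfolding u_def
    proof (rule merit_decrease[OF bdd w(1)])
      fix i
      have "w i * (K * \<rho> k * q k) \<le> \<alpha> k i * (K * \<rho> k * q k)"
        using w(2) K \<rho>(1)[of k] q(2)[of k] by (intro mult_right_mono) auto
      then show "F (x (Suc k)) $ i \<le> F (x k) $ i - w i * (K * \<rho> k * q k)"
        using decrease[of k i] by (simp add: mult_ac)
    qed
    ultimately have "u (x (Suc k)) \<le> (1 - K * (1 - c * \<alpha>min) * T) * u (x k)"
      by (simp add: left_diff_distrib)
    then show ?thesis
      unfolding u_def w_def c_def T_def K_def S_def .
  qed
  ultimately show ?thesis
    by blast
qed

end
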